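(* Let $\lambda$ be a deformation of a multiplicative Hom-Leibniz algebra $(\mathcal{L},[.,.],\alpha)$ over $\mathbb{K}$ with finite-dimensional local base $A$, and let $B$ be a $1$-dimensional extension of $A$ corresponding to the cohomology class $[f]\in H^2_{Harr}(A,\mathbb{K})$. Then $\lambda$ can be extended to a deformation of $\mathcal{L}$ with base $B$ (i.e. there is a deformation $\mu$ of $\mathcal{L}$ with base $B$ with $p_\ast\mu=\lambda$, where $p:B\to A$ is the projection) if and only if the obstruction $\theta_\lambda([f])\in H^3(\mathcal{L},\mathcal{L})$ is $0$.
   Context: $\mathbb{K}$ is an algebraically closed field of characteristic $0$. A (multiplicative) Hom-Leibniz algebra $(\mathcal{L},[.,.],\alpha)$ is a $\mathbb{K}$-vector space with a bilinear bracket and a linear map $\alpha:\mathcal{L}\to\mathcal{L}$ such that $[\alpha(x),[y,z]]=[[x,y],\alpha(z)]-[[x,z],\alpha(y)]$ and $\alpha([x,y])=[\alpha(x),\alpha(y)]$. $\mathcal{C}^n(\mathcal{L},\mathcal{L})$ is the space of $n$-linear maps $\varphi:\mathcal{L}^n\to\mathcal{L}$ with $\alpha\circ\varphi=\varphi\circ(\alpha,\dots,\alpha)$, with coboundary $$\delta^n\varphi(x_1,\dots,x_{n+1})=[\alpha^{n-1}(x_1),\varphi(x_2,\dots,x_{n+1})]+\sum_{i=2}^{n+1}(-1)^i[\varphi(x_1,\dots,\widehat{x_i},\dots,x_{n+1}),\alpha^{n-1}(x_i)]$$ $$+\sum_{1\le i<j\le n+1}(-1)^{j+1}\varphi(\alpha(x_1),\dots,\alpha(x_{i-1}),[x_i,x_j],\alpha(x_{i+1}),\dots,\widehat{x_j},\dots,\alpha(x_{n+1})),$$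 and $H^n(\mathcal{L},\mathcal{L})$ is its cohomology. A deformation $\lambda$ of $\mathcal{L}$ with base a commutative unital $\mathbb{K}$-algebra $A$ with augmentation $\varepsilon:A\to\mathbb{K}$ is an $A$-bilinear bracket $[.,.]_\lambda$ on $A\otimes\mathcal{L}$ making $(A\otimes\mathcal{L},[.,.]_\lambda,\mathrm{id}\otimes\alpha)$ a (multiplicative) Hom-Leibniz algebra and such that $(\varepsilon\otimes\mathrm{id})[1\otimes l_1,1\otimes l_2]_\lambda=[l_1,l_2]$. For a unital homomorphism $p:B\to A$ compatible with augmentations, the push-out $p_\ast\mu$ of a deformation $\mu$ with base $B$ is the deformation with base $A$ given by $[1\otimes l_1,1\otimes l_2]_{p_\ast\mu}=(p\otimes\mathrm{id})[1\otimes l_1,1\otimes l_2]_\mu$. A $1$-dimensional extension of $A$ is a commutative unital $\mathbb{K}$-algebra $B$ with an exact sequence of vector spaces $0\to\mathbb{K}\xrightarrow{i}B\xrightarrow{p}A\to0$, $p$ an algebra homomorphism, $i(k)\,b=i(\varepsilon(p(b))k)$, $i(\mathbb{K})^2=0$; $\mathbb{K}$ is an $A$-module through $\varepsilon$, and $B$ has augmentation $\varepsilon\circ p$. Isomorphism classes of such extensions correspond bijectively to elements of the Harrison cohomology $H^2_{Harr}(A,\mathbb{K})$ (symmetric Hochschild $2$-cocycles $f:A\times A\to\mathbb{K}$ modulo coboundaries of linear maps $A\to\mathbb{K}$): $f$ corresponds to $A\oplus\mathbb{K}$ with $(a_1,k_1)(a_2,k_2)=(a_1a_2,\varepsilon(a_1)k_2+\varepsilon(a_2)k_1+f(a_1,a_2))$.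 Obstruction map $\theta_\lambda:H^2_{Harr}(A,\mathbb{K})\to H^3(\mathcal{L},\mathcal{L})$. Given an extension $B$ of class $[f]$, put $P=p\otimes\mathrm{id}:B\otimes\mathcal{L}\to A\otimes\mathcal{L}$, $E=(\varepsilon\circ p)\otimes\mathrm{id}:B\otimes\mathcal{L}\to\mathcal{L}$, $I=i\otimes\mathrm{id}:\mathcal{L}\to B\otimes\mathcal{L}$. Choose a $B$-bilinear operation $\{.,.\}$ on $B\otimes\mathcal{L}$ commuting with $\mathrm{id}\otimes\alpha$ and satisfying $P\{u,v\}=[P(u),P(v)]_\lambda$ and $\{I(l),u\}=I([l,E(u)])$. Define $\bar\phi\in\mathcal{C}^3(\mathcal{L},\mathcal{L})$ by $i(1)\otimes\bar\phi(l_1,l_2,l_3)=\{1\otimes\alpha(l_1),\{1\otimes l_2,1\otimes l_3\}\}-\{\{1\otimes l_1,1\otimes l_2\},1\otimes\alpha(l_3)\}+\{\{1\otimes l_1,1\otimes l_3\},1\otimes\alpha(l_2)\}$. Then $\bar\phi$ is a $3$-cocycle whose class does not depend on the choice of $\{.,.\}$, and $\theta_\lambda([f])=[\bar\phi]$. *)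

theory Defs
  imports
    "HOL-Computational_Algebra.Polynomial"
    "HOL-Library.Function_Algebras"
    "HOL-Library.Set_Algebras"
    "HOL-Library.Product_Plus"
begin

section \<open>Tensor products of vector spaces\<close>

text \<open>
  Vector spaces are whole types with an explicit scalar multiplication. The tensor product
  \<open>V \<otimes> W\<close> over a field is realised inside the maps from the dual of \<open>V\<close> to \<open>W\<close>: the pure
  tensor of \<open>v\<close> and \<open>w\<close> is the map \<open>\<xi> \<mapsto> \<xi>(v) w\<close>, and \<open>V \<otimes> W\<close> is the span of the pure
  tensors. Maps are put to 0 outside the dual, so that equality of tensors is equality of
  functions; addition is the pointwise one. Lemma \<open>tensor_universal_property\<close> below is the
  universal property for finite-dimensional \<open>V\<close>, the only case that is needed.
\<close>

definition pt_scale :: "('k \<Rightarrow> 'w \<Rightarrow> 'w) \<Rightarrow> 'k \<Rightarrow> ('x \<Rightarrow> 'w) \<Rightarrow> 'x \<Rightarrow> 'w" where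
  "pt_scale s c u = (\<lambda>x. s c (u x))"

definition dual :: "('k::field \<Rightarrow> 'v::ab_group_add \<Rightarrow> 'v) \<Rightarrow> ('v \<Rightarrow> 'k) set" where
  "dual s = {\<xi>. Vector_Spaces.linear s (*) \<xi>}"

definition pure_tensor ::
  "('k::field \<Rightarrow> 'v::ab_group_add \<Rightarrow> 'v) \<Rightarrow> ('k \<Rightarrow> 'w::ab_group_add \<Rightarrow> 'w)
    \<Rightarrow> 'v \<Rightarrow> 'w \<Rightarrow> ('v \<Rightarrow> 'k) \<Rightarrow> 'w" where
  "pure_tensor sV sW v w = (\<lambda>\<xi>. if \<xi> \<in> dual sV then sW (\<xi> v) w else 0)"

definition tensor_space ::
  "('k::field \<Rightarrow> 'v::ab_group_add \<Rightarrow> 'v) \<Rightarrow> ('k \<Rightarrow> 'w::ab_group_add \<Rightarrow> 'w)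
    \<Rightarrow> (('v \<Rightarrow> 'k) \<Rightarrow> 'w) set" where
  "tensor_space sV sW = module.span (pt_scale sW) {pure_tensor sV sW v w | v w. True}"

text \<open>
  The map \<open>f \<otimes> g\<close> for linear \<open>f : V \<rightarrow> V'\<close> and \<open>g : W \<rightarrow> W'\<close>; the first argument is the scalar
  multiplication of \<open>V'\<close>. See lemma \<open>tensor_map_pure\<close>.
\<close>

definition tensor_map ::
  "('k::field \<Rightarrow> 'v2::ab_group_add \<Rightarrow> 'v2) \<Rightarrow> ('v1 \<Rightarrow> 'v2) \<Rightarrow> ('w1 \<Rightarrow> 'w2::zero)
    \<Rightarrow> (('v1 \<Rightarrow> 'k) \<Rightarrow> 'w1) \<Rightarrow> ('v2 \<Rightarrow> 'k) \<Rightarrow> 'w2" where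
  "tensor_map sV' f g u = (\<lambda>\<xi>. if \<xi> \<in> dual sV' then g (u (\<xi> \<circ> f)) else 0)"

text \<open>
  The map \<open>\<xi> \<otimes> id : V \<otimes> W \<rightarrow> W\<close> for \<open>\<xi>\<close> in the dual of \<open>V\<close>, with \<open>\<bbbK> \<otimes> W\<close> identified with \<open>W\<close>.
  See lemma \<open>contraction_pure\<close>.
\<close>

definition contraction :: "('v \<Rightarrow> 'k) \<Rightarrow> (('v \<Rightarrow> 'k) \<Rightarrow> 'w) \<Rightarrow> 'w" where
  "contraction \<xi> u = u \<xi>"

lemma contraction_pure:
  "\<xi> \<in> dual sV \<Longrightarrow> contraction \<xi> (pure_tensor sV sW v w) = sW (\<xi> v) w"
  by (simp add: contraction_def pure_tensor_def)

lemma vector_space_pt_scale: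
  assumes "vector_space s"
  shows "vector_space (pt_scale s)"
proof -
  interpret vector_space s by fact
  show ?thesis
    by unfold_locales
      (auto simp: pt_scale_def fun_eq_iff scale_right_distrib scale_left_distrib)
qed

lemma tensor_map_pure:
  assumes "Vector_Spaces.linear sV sV' f" "Vector_Spaces.linear sW sW' g"
  shows "tensor_map sV' f g (pure_tensor sV sW v w) = pure_tensor sV' sW' (f v) (g w)"
proof -
  have "\<xi> \<circ> f \<in> dual sV" if "\<xi> \<in> dual sV'" for \<xi>
    using that assms(1) unfolding dual_def
    by (auto intro: Vector_Spaces.linear_compose)
  moreover have "g (sW c x) = sW' c (g x)" for c x
    using assms(2) by (simp add: Vector_Spaces.linear_iff)
  ultimately show ?thesis
    by (auto simp: tensor_map_def pure_tensor_def fun_eq_iff)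
qed

lemma tensor_universal_property:
  assumes V: "finite_dimensional_vector_space sV Bas" and W: "vector_space sW" and U: "vector_space sU"
    and f1: "\<And>w. Vector_Spaces.linear sV sU (\<lambda>v. f v w)"
    and f2: "\<And>v. Vector_Spaces.linear sW sU (f v)"
  shows "\<exists>F. Vector_Spaces.linear (pt_scale sW) sU F \<and> (\<forall>v w. F (pure_tensor sV sW v w) = f v w)"
    and "\<And>F G u. Vector_Spaces.linear (pt_scale sW) sU F \<Longrightarrow> Vector_Spaces.linear (pt_scale sW) sU G
      \<Longrightarrow> (\<And>v w. F (pure_tensor sV sW v w) = G (pure_tensor sV sW v w))
      \<Longrightarrow> u \<in> tensor_space sV sW \<Longrightarrow> F u = G u"
proof -
  interpret V: finite_dimensional_vector_space sV Bas by fact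
  interpret W: vector_space sW by fact
  interpret U: vector_space sU by fact
  interpret T: vector_space "pt_scale sW :: 'a \<Rightarrow> (('b \<Rightarrow> 'a) \<Rightarrow> 'c) \<Rightarrow> _" by (rule vector_space_pt_scale[OF W])
  define r where "r b = (\<lambda>v. V.representation Bas v b)" for b
  have r: "r b \<in> dual sV" for b
    unfolding dual_def r_def
    using V.linear_representation[OF V.independent_Basis V.span_Basis] by simp
  define F where "F u = (\<Sum>b\<in>Bas. f b (u (r b)))" for u
  have f2': "f b (x + y) = f b x + f b y" "f b (sW c x) = sU c (f b x)" for b x y c
    using f2[of b] by (simp_all add: Vector_Spaces.linear_iff)
  have "Vector_Spaces.linear (pt_scale sW) sU F"
    unfolding Vector_Spaces.linear_iff F_def
    using T.vector_space_axioms U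
    by (auto simp: f2' sum.distrib U.scale_sum_right) (auto simp: pt_scale_def f2')
  moreover have "F (pure_tensor sV sW v w) = f v w" for v w
  proof -
    interpret f: Vector_Spaces.linear sV sU "\<lambda>v. f v w" by (rule f1)
    have "F (pure_tensor sV sW v w) = (\<Sum>b\<in>Bas. sU (r b v) (f b w))"
      using r by (simp add: F_def pure_tensor_def f2')
    also have "\<dots> = f (\<Sum>b\<in>Bas. sV (r b v) b) w"
      by (simp add: f.sum f.scale)
    also have "(\<Sum>b\<in>Bas. sV (r b v) b) = v"
      unfolding r_def
      by (rule V.sum_representation_eq)
        (auto simp: V.independent_Basis V.span_Basis V.finite_Basis)
    finally show ?thesis .
  qed
  ultimately show "\<exists>F. Vector_Spaces.linear (pt_scale sW) sU F \<and> (\<forall>v w. F (pure_tensor sV sW v w) = f v w)"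
    by blast
  show "F u = G u"
    if "Vector_Spaces.linear (pt_scale sW) sU F" "Vector_Spaces.linear (pt_scale sW) sU G"
      "\<And>v w. F (pure_tensor sV sW v w) = G (pure_tensor sV sW v w)" "u \<in> tensor_space sV sW" for F G u
  proof -
    interpret vector_space_pair "pt_scale sW :: 'a \<Rightarrow> (('b \<Rightarrow> 'a) \<Rightarrow> 'c) \<Rightarrow> _" sU ..
    show ?thesis
      by (rule linear_eq_on[OF that(1,2)])
        (use that(3,4) in \<open>auto simp: tensor_space_def\<close>)
  qed
qed


section \<open>Augmented commutative algebras\<close>

record ('k, 'a) aug_algebra =
  ascale :: "'k \<Rightarrow> 'a \<Rightarrow> 'a"
  amult :: "'a \<Rightarrow> 'a \<Rightarrow> 'a"
  aone :: "'a"
  aug :: "'a \<Rightarrow> 'k"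

definition augmented_algebra :: "('k::field, 'a::ab_group_add) aug_algebra \<Rightarrow> bool" where
  "augmented_algebra A \<longleftrightarrow>
     vector_space (ascale A) \<and>
     class.comm_ring_1 (amult A) (aone A) (+) 0 (-) uminus \<and>
     (\<forall>c a b. amult A (ascale A c a) b = ascale A c (amult A a b)) \<and>
     Vector_Spaces.linear (ascale A) (*) (aug A) \<and>
     (\<forall>a b. aug A (amult A a b) = aug A a * aug A b) \<and>
     aug A (aone A) = 1"

definition finite_dimensional_algebra :: "('k::field, 'a::ab_group_add) aug_algebra \<Rightarrow> bool" where
  "finite_dimensional_algebra A \<longleftrightarrow> (\<exists>Bas. finite_dimensional_vector_space (ascale A) Bas)"

definition algebra_ideal :: "('k, 'a::ab_group_add) aug_algebra \<Rightarrow> 'a set \<Rightarrow> bool" where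
  "algebra_ideal A I \<longleftrightarrow>
     0 \<in> I \<and> (\<forall>x\<in>I. \<forall>y\<in>I. x + y \<in> I) \<and> (\<forall>a. \<forall>x\<in>I. amult A a x \<in> I)"

definition algebra_maximal_ideal :: "('k, 'a::ab_group_add) aug_algebra \<Rightarrow> 'a set \<Rightarrow> bool" where
  "algebra_maximal_ideal A M \<longleftrightarrow>
     algebra_ideal A M \<and> M \<noteq> UNIV \<and>
     (\<forall>I. algebra_ideal A I \<and> M \<subseteq> I \<and> I \<noteq> UNIV \<longrightarrow> I = M)"

definition local_algebra :: "('k, 'a::ab_group_add) aug_algebra \<Rightarrow> bool" where
  "local_algebra A \<longleftrightarrow> (\<exists>!M. algebra_maximal_ideal A M)"

definition algebra_hom ::
  "('k::field, 'b::ab_group_add) aug_algebra \<Rightarrow> ('k, 'a::ab_group_add) aug_algebra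
    \<Rightarrow> ('b \<Rightarrow> 'a) \<Rightarrow> bool" where
  "algebra_hom B A p \<longleftrightarrow>
     Vector_Spaces.linear (ascale B) (ascale A) p \<and>
     (\<forall>x y. p (amult B x y) = amult A (p x) (p y)) \<and>
     p (aone B) = aone A"


section \<open>One-dimensional extensions and Harrison cohomology\<close>

definition extension ::
  "('k::field, 'a::ab_group_add) aug_algebra \<Rightarrow> ('k, 'b::ab_group_add) aug_algebra
    \<Rightarrow> ('k \<Rightarrow> 'b) \<Rightarrow> ('b \<Rightarrow> 'a) \<Rightarrow> bool" where
  "extension A B i p \<longleftrightarrow>
     augmented_algebra B \<and>
     Vector_Spaces.linear (*) (ascale B) i \<and> inj i \<and>
     algebra_hom B A p \<and> surj p \<and>
     range i = {b. p b = 0} \<and>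
     (\<forall>k b. amult B (i k) b = i (aug A (p b) * k)) \<and>
     (\<forall>k k'. amult B (i k) (i k') = 0) \<and>
     aug B = aug A \<circ> p"

definition extension_iso ::
  "('k::field, 'b::ab_group_add) aug_algebra \<Rightarrow> ('k \<Rightarrow> 'b) \<Rightarrow> ('b \<Rightarrow> 'a)
    \<Rightarrow> ('k, 'c::ab_group_add) aug_algebra \<Rightarrow> ('k \<Rightarrow> 'c) \<Rightarrow> ('c \<Rightarrow> 'a) \<Rightarrow> bool" where
  "extension_iso B i p B' i' p' \<longleftrightarrow>
     (\<exists>h. algebra_hom B B' h \<and> bij h \<and> h \<circ> i = i' \<and> p' \<circ> h = p)"

text \<open>Scalars form an \<open>A\<close>-module through the augmentation.\<close>

definition harrison_cocycles ::
  "('k::field, 'a::ab_group_add) aug_algebra \<Rightarrow> ('a \<Rightarrow> 'a \<Rightarrow> 'k) set" where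
  "harrison_cocycles A = {f.
     (\<forall>a. Vector_Spaces.linear (ascale A) (*) (f a)) \<and>
     (\<forall>b. Vector_Spaces.linear (ascale A) (*) (\<lambda>a. f a b)) \<and>
     (\<forall>a b. f a b = f b a) \<and>
     (\<forall>a b c. aug A a * f b c - f (amult A a b) c + f a (amult A b c) - f a b * aug A c = 0)}"

definition harrison_coboundaries ::
  "('k::field, 'a::ab_group_add) aug_algebra \<Rightarrow> ('a \<Rightarrow> 'a \<Rightarrow> 'k) set" where
  "harrison_coboundaries A =
     {(\<lambda>a b. aug A a * g b - g (amult A a b) + g a * aug A b) | g.
        Vector_Spaces.linear (ascale A) (*) g}"

definition harrison_class ::
  "('k::field, 'a::ab_group_add) aug_algebra \<Rightarrow> ('a \<Rightarrow> 'a \<Rightarrow> 'k) \<Rightarrow> ('a \<Rightarrow> 'a \<Rightarrow> 'k) set" where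
  "harrison_class A f = f +o harrison_coboundaries A"

definition harrison_cohomology ::
  "('k::field, 'a::ab_group_add) aug_algebra \<Rightarrow> ('a \<Rightarrow> 'a \<Rightarrow> 'k) set set" where
  "harrison_cohomology A = harrison_class A ` harrison_cocycles A"

text \<open>
  The unit of the extension given by a cocycle \<open>f\<close> is \<open>(1, - f 1 1)\<close>, since \<open>f\<close> need not be
  normalised.
\<close>

definition cocycle_extension ::
  "('k::field, 'a::ab_group_add) aug_algebra \<Rightarrow> ('a \<Rightarrow> 'a \<Rightarrow> 'k) \<Rightarrow> ('k, 'a \<times> 'k) aug_algebra" where
  "cocycle_extension A f = \<lparr>
     ascale = (\<lambda>c (a, k). (ascale A c a, c * k)),
     amult = (\<lambda>(a1, k1) (a2, k2). (amult A a1 a2, aug A a1 * k2 + aug A a2 * k1 + f a1 a2)),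
     aone = (aone A, - f (aone A) (aone A)),
     aug = (\<lambda>(a, k). aug A a) \<rparr>"

definition extension_of_class ::
  "('k::field, 'a::ab_group_add) aug_algebra \<Rightarrow> ('k, 'b::ab_group_add) aug_algebra
    \<Rightarrow> ('k \<Rightarrow> 'b) \<Rightarrow> ('b \<Rightarrow> 'a) \<Rightarrow> ('a \<Rightarrow> 'a \<Rightarrow> 'k) set \<Rightarrow> bool" where
  "extension_of_class A B i p c \<longleftrightarrow>
     extension A B i p \<and> c \<in> harrison_cohomology A \<and>
     (\<exists>f\<in>c. extension_iso (cocycle_extension A f) (\<lambda>k. (0, k)) fst B i p)"


section \<open>Hom-Leibniz algebras and their cohomology\<close>

record ('k, 'l) hom_algebra =
  lscale :: "'k \<Rightarrow> 'l \<Rightarrow> 'l"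
  lbracket :: "'l \<Rightarrow> 'l \<Rightarrow> 'l"
  ltwist :: "'l \<Rightarrow> 'l"

text \<open>
  Bilinearity of an operation on a carrier \<open>V\<close> with respect to an action of scalars, which is
  used both for scalars in the ground field and for scalars in the base of a deformation.
\<close>

definition bilinear_operation ::
  "('r \<Rightarrow> 'v \<Rightarrow> 'v) \<Rightarrow> 'v::ab_group_add set \<Rightarrow> ('v \<Rightarrow> 'v \<Rightarrow> 'v) \<Rightarrow> bool" where
  "bilinear_operation act V br \<longleftrightarrow>
     (\<forall>u\<in>V. \<forall>v\<in>V. br u v \<in> V) \<and>
     (\<forall>u\<in>V. \<forall>v\<in>V. \<forall>w\<in>V. br (u + v) w = br u w + br v w \<and> br u (v + w) = br u v + br u w) \<and>
     (\<forall>r. \<forall>u\<in>V. \<forall>v\<in>V. br (act r u) v = act r (br u v) \<and> br u (act r v) = act r (br u v))"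

definition hom_leibniz ::
  "('r \<Rightarrow> 'v \<Rightarrow> 'v) \<Rightarrow> 'v::ab_group_add set \<Rightarrow> ('v \<Rightarrow> 'v \<Rightarrow> 'v) \<Rightarrow> ('v \<Rightarrow> 'v) \<Rightarrow> bool" where
  "hom_leibniz act V br \<alpha> \<longleftrightarrow>
     bilinear_operation act V br \<and>
     (\<forall>u\<in>V. \<alpha> u \<in> V) \<and>
     (\<forall>u\<in>V. \<forall>v\<in>V. \<alpha> (u + v) = \<alpha> u + \<alpha> v) \<and>
     (\<forall>r. \<forall>u\<in>V. \<alpha> (act r u) = act r (\<alpha> u)) \<and>
     (\<forall>x\<in>V. \<forall>y\<in>V. \<forall>z\<in>V. br (\<alpha> x) (br y z) = br (br x y) (\<alpha> z) - br (br x z) (\<alpha> y)) \<and>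
     (\<forall>x\<in>V. \<forall>y\<in>V. \<alpha> (br x y) = br (\<alpha> x) (\<alpha> y))"

definition hom_leibniz_algebra :: "('k::field, 'l::ab_group_add) hom_algebra \<Rightarrow> bool" where
  "hom_leibniz_algebra L \<longleftrightarrow>
     vector_space (lscale L) \<and> hom_leibniz (lscale L) UNIV (lbracket L) (ltwist L)"

text \<open>
  A cochain of degree \<open>n\<close> is a function on lists of length \<open>n\<close>, put to 0 on all other lists.
\<close>

definition cochains :: "('k::field, 'l::ab_group_add) hom_algebra \<Rightarrow> nat \<Rightarrow> ('l list \<Rightarrow> 'l) set" where
  "cochains L n = {\<phi>.
     (\<forall>xs. length xs \<noteq> n \<longrightarrow> \<phi> xs = 0) \<and>
     (\<forall>xs k. length xs = n \<and> k < n \<longrightarrow>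
        Vector_Spaces.linear (lscale L) (lscale L) (\<lambda>x. \<phi> (xs[k := x]))) \<and>
     (\<forall>xs. length xs = n \<longrightarrow> ltwist L (\<phi> xs) = \<phi> (map (ltwist L) xs))}"

text \<open>Entries are numbered from 1 in \<open>omit\<close> and \<open>coboundary\<close>.\<close>

definition omit :: "nat \<Rightarrow> 'x list \<Rightarrow> 'x list" where
  "omit j xs = take (j - 1) xs @ drop j xs"

definition coboundary ::
  "('k::field, 'l::ab_group_add) hom_algebra \<Rightarrow> nat \<Rightarrow> ('l list \<Rightarrow> 'l) \<Rightarrow> 'l list \<Rightarrow> 'l" where
  "coboundary L n \<phi> xs =
     (let x = (\<lambda>i. xs ! (i - 1)); \<alpha> = ltwist L; br = lbracket L; s = lscale L in
      if length xs = n + 1 then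
        br ((\<alpha> ^^ (n - 1)) (x 1)) (\<phi> (omit 1 xs))
        + (\<Sum>i = 2..n + 1. s ((-1) ^ i) (br (\<phi> (omit i xs)) ((\<alpha> ^^ (n - 1)) (x i))))
        + (\<Sum>i = 1..n. \<Sum>j = i + 1..n + 1.
             s ((-1) ^ (j + 1)) (\<phi> (omit j ((map \<alpha> xs)[i - 1 := br (x i) (x j)]))))
      else 0)"

definition cocycles :: "('k::field, 'l::ab_group_add) hom_algebra \<Rightarrow> nat \<Rightarrow> ('l list \<Rightarrow> 'l) set" where
  "cocycles L n = {\<phi> \<in> cochains L n. coboundary L n \<phi> = 0}"

text \<open>The complex starts in degree 1.\<close>

definition coboundaries :: "('k::field, 'l::ab_group_add) hom_algebra \<Rightarrow> nat \<Rightarrow> ('l list \<Rightarrow> 'l) set" where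
  "coboundaries L n = (if n \<le> 1 then {0} else coboundary L (n - 1) ` cochains L (n - 1))"

definition cohomology_class ::
  "('k::field, 'l::ab_group_add) hom_algebra \<Rightarrow> nat \<Rightarrow> ('l list \<Rightarrow> 'l) \<Rightarrow> ('l list \<Rightarrow> 'l) set" where
  "cohomology_class L n \<phi> = \<phi> +o coboundaries L n"

definition cohomology ::
  "('k::field, 'l::ab_group_add) hom_algebra \<Rightarrow> nat \<Rightarrow> ('l list \<Rightarrow> 'l) set set" where
  "cohomology L n = cohomology_class L n ` cocycles L n"


section \<open>Deformations\<close>

type_synonym ('k, 'a, 'l) tensor = "('a \<Rightarrow> 'k) \<Rightarrow> 'l"

abbreviation base_change ::
  "('k::field, 'a::ab_group_add) aug_algebra \<Rightarrow> ('k, 'l::ab_group_add) hom_algebra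
    \<Rightarrow> ('k, 'a, 'l) tensor set" where
  "base_change A L \<equiv> tensor_space (ascale A) (lscale L)"

abbreviation tensor ::
  "('k::field, 'a::ab_group_add) aug_algebra \<Rightarrow> ('k, 'l::ab_group_add) hom_algebra
    \<Rightarrow> 'a \<Rightarrow> 'l \<Rightarrow> ('k, 'a, 'l) tensor" where
  "tensor A L \<equiv> pure_tensor (ascale A) (lscale L)"

text \<open>The \<open>A\<close>-module structure on \<open>A \<otimes> L\<close>, with \<open>a (b \<otimes> l) = (a b) \<otimes> l\<close>.\<close>

definition base_action ::
  "('k::field, 'a::ab_group_add) aug_algebra \<Rightarrow> 'a \<Rightarrow> ('k, 'a, 'l::ab_group_add) tensor
    \<Rightarrow> ('k, 'a, 'l) tensor" where
  "base_action A a = tensor_map (ascale A) (amult A a) id"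

definition base_twist ::
  "('k::field, 'a::ab_group_add) aug_algebra \<Rightarrow> ('k, 'l::ab_group_add) hom_algebra
    \<Rightarrow> ('k, 'a, 'l) tensor \<Rightarrow> ('k, 'a, 'l) tensor" where
  "base_twist A L = tensor_map (ascale A) id (ltwist L)"

text \<open>Brackets are only relevant on the carrier \<open>A \<otimes> L\<close>.\<close>

definition deformation ::
  "('k::field, 'a::ab_group_add) aug_algebra \<Rightarrow> ('k, 'l::ab_group_add) hom_algebra
    \<Rightarrow> (('k, 'a, 'l) tensor \<Rightarrow> ('k, 'a, 'l) tensor \<Rightarrow> ('k, 'a, 'l) tensor) \<Rightarrow> bool" where
  "deformation A L lam \<longleftrightarrow>
     hom_leibniz (base_action A) (base_change A L) lam (base_twist A L) \<and>
     (\<forall>x y. contraction (aug A) (lam (tensor A L (aone A) x) (tensor A L (aone A) y))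
              = lbracket L x y)"

text \<open>
  By \<open>A\<close>-bilinearity these conditions determine \<open>nu\<close> on \<open>A \<otimes> L\<close>, so they say that the
  push-out of \<open>mu\<close> along \<open>p : B \<rightarrow> A\<close> is \<open>nu\<close>.
\<close>

definition is_push_out ::
  "('k::field, 'b::ab_group_add) aug_algebra \<Rightarrow> ('k, 'a::ab_group_add) aug_algebra
    \<Rightarrow> ('k, 'l::ab_group_add) hom_algebra \<Rightarrow> ('b \<Rightarrow> 'a)
    \<Rightarrow> (('k, 'b, 'l) tensor \<Rightarrow> ('k, 'b, 'l) tensor \<Rightarrow> ('k, 'b, 'l) tensor)
    \<Rightarrow> (('k, 'a, 'l) tensor \<Rightarrow> ('k, 'a, 'l) tensor \<Rightarrow> ('k, 'a, 'l) tensor) \<Rightarrow> bool" where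
  "is_push_out B A L p mu nu \<longleftrightarrow>
     deformation A L nu \<and>
     (\<forall>x y. nu (tensor A L (aone A) x) (tensor A L (aone A) y)
          = tensor_map (ascale A) p id (mu (tensor B L (aone B) x) (tensor B L (aone B) y)))"


section \<open>The obstruction map\<close>

text \<open>In the following two definitions \<open>P\<close>, \<open>E\<close>, \<open>I\<close> are the maps \<open>p \<otimes> id\<close>,
  \<open>(\<epsilon> \<circ> p) \<otimes> id\<close>, \<open>i \<otimes> id\<close>, where \<open>\<bbbK> \<otimes> L\<close> is identified with \<open>L\<close>.\<close>

definition lifted_operation ::
  "('k::field, 'a::ab_group_add) aug_algebra \<Rightarrow> ('k, 'b::ab_group_add) aug_algebra
    \<Rightarrow> ('k \<Rightarrow> 'b) \<Rightarrow> ('b \<Rightarrow> 'a) \<Rightarrow> ('k, 'l::ab_group_add) hom_algebra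
    \<Rightarrow> (('k, 'a, 'l) tensor \<Rightarrow> ('k, 'a, 'l) tensor \<Rightarrow> ('k, 'a, 'l) tensor)
    \<Rightarrow> (('k, 'b, 'l) tensor \<Rightarrow> ('k, 'b, 'l) tensor \<Rightarrow> ('k, 'b, 'l) tensor) \<Rightarrow> bool" where
  "lifted_operation A B i p L lam br \<longleftrightarrow>
     (let T = base_change B L; P = tensor_map (ascale A) p id;
          E = contraction (aug A \<circ> p); I = tensor B L (i 1) in
      bilinear_operation (base_action B) T br \<and>
      (\<forall>u\<in>T. \<forall>v\<in>T. base_twist B L (br u v) = br (base_twist B L u) (base_twist B L v)) \<and>
      (\<forall>u\<in>T. \<forall>v\<in>T. P (br u v) = lam (P u) (P v)) \<and>
      (\<forall>x. \<forall>u\<in>T. br (I x) u = I (lbracket L x (E u))))"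

definition obstruction_cochain ::
  "('k::field, 'b::ab_group_add) aug_algebra \<Rightarrow> ('k \<Rightarrow> 'b) \<Rightarrow> ('k, 'l::ab_group_add) hom_algebra
    \<Rightarrow> (('k, 'b, 'l) tensor \<Rightarrow> ('k, 'b, 'l) tensor \<Rightarrow> ('k, 'b, 'l) tensor)
    \<Rightarrow> ('l list \<Rightarrow> 'l) \<Rightarrow> bool" where
  "obstruction_cochain B i L br \<phi> \<longleftrightarrow>
     (let e = tensor B L (aone B); I = tensor B L (i 1); \<alpha> = ltwist L in
      \<phi> \<in> cochains L 3 \<and>
      (\<forall>x y z. I (\<phi> [x, y, z]) =
         br (e (\<alpha> x)) (br (e y) (e z)) - br (br (e x) (e y)) (e (\<alpha> z))
         + br (br (e x) (e z)) (e (\<alpha> y))))"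

text \<open>
  The obstruction map sends the class \<open>c\<close> to the class of any cochain obtained from any extension
  of class \<open>c\<close> and any choice of lifted operation. It is enough to consider extensions on the type
  \<open>'a \<times> 'k\<close>, since every one-dimensional extension of \<open>A\<close> is isomorphic to one on that type.
\<close>

definition obstruction ::
  "('k::field, 'a::ab_group_add) aug_algebra \<Rightarrow> ('k, 'l::ab_group_add) hom_algebra
    \<Rightarrow> (('k, 'a, 'l) tensor \<Rightarrow> ('k, 'a, 'l) tensor \<Rightarrow> ('k, 'a, 'l) tensor)
    \<Rightarrow> ('a \<Rightarrow> 'a \<Rightarrow> 'k) set \<Rightarrow> ('l list \<Rightarrow> 'l) set" where
  "obstruction A L lam c =
     (THE h. h \<in> cohomology L 3 \<and>
        (\<exists>(B :: ('k, 'a \<times> 'k) aug_algebra) i p br \<phi>.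
           extension_of_class A B i p c \<and> lifted_operation A B i p L lam br \<and>
           obstruction_cochain B i L br \<phi> \<and> h = cohomology_class L 3 \<phi>))"

end

theory Submission
  imports Defs
begin

text \<open>
  The bracket of a deformation with base \<open>B\<close> extending \<open>\<lambda>\<close> is in particular an operation as used
  in the construction of the obstruction: a \<open>B\<close>-bilinear operation on \<open>B \<otimes> L\<close> that commutes with
  the twist and lies over \<open>\<lambda>\<close>. Call such an operation a lift. A lift is a deformation extending
  \<open>\<lambda>\<close> exactly if its Leibniz defect
  \<open>J u v w = {\<alpha> u, {v, w}} - {{u, v}, \<alpha> w} + {{u, w}, \<alpha> v}\<close> vanishes
  (\<open>deformation_iff_lift\<close>), so the theorem asks whether the lift can be chosen with
  \<open>J = 0\<close>.

  Everything rests on one property of the extension: the kernel of \<open>P = p \<otimes> id\<close> is a copy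
  \<open>I L = i(1) \<otimes> L\<close> of \<open>L\<close> (\<open>kernel_P\<close>), on which \<open>B\<close> acts through its augmentation. Hence a
  \<open>B\<close>-multilinear map with values in the kernel factors through \<open>E : B \<otimes> L \<rightarrow> L\<close> in each
  argument (\<open>base_linear_factors\<close>), and so amounts to a multilinear map on \<open>L\<close>. Two such maps matter.

  First, the Leibniz rule for \<open>\<lambda>\<close> puts \<open>J\<close> into the kernel, so
  \<open>J u v w = I (\<phi> (E u, E v, E w))\<close> for a 3-cochain \<open>\<phi>\<close>. Expanding all brackets gives an identity
  for \<open>J\<close> that has the shape of the cocycle condition (\<open>defect_cocycle_identity\<close>), and so
  \<open>\<phi>\<close> is a cocycle.

  Second, two lifts of \<open>\<lambda>\<close> differ by a map into the kernel, that is by \<open>I (\<psi> (E u, E v))\<close> for a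
  2-cochain \<open>\<psi>\<close>, and conversely every \<open>\<psi>\<close> gives a new lift. Since brackets of two elements of the
  kernel vanish, the defect changes by a term linear in \<open>\<psi>\<close>, and this term is the coboundary of
  \<open>\<psi>\<close> (\<open>defect_shift\<close>). So the class of \<open>\<phi>\<close> is independent of the lift, and a representative
  \<open>\<phi> = \<delta> \<psi>\<close> of the zero class can be cancelled by changing the lift by \<open>\<psi>\<close>.

  It remains to see that lifts exist (\<open>lift_exists\<close>): compose \<open>\<lambda>\<close> on the elements \<open>1 \<otimes> x\<close> with
  \<open>\<sigma> \<otimes> id\<close> for a linear section \<open>\<sigma>\<close> of \<open>p\<close>, and extend \<open>B\<close>-bilinearly. Finally, isomorphic
  extensions have the same obstruction cochains (\<open>transport_lift\<close>), so that the obstruction of a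
  Harrison class can be computed from any extension in that class.
\<close>

section \<open>Tensors as maps on the dual space\<close>

text \<open>
  Tensors are functions but are treated as vectors here. Sums of tensors are evaluated only on
  request, since otherwise the simplifier would also unfold the eta-expanded sums that
  unification produces in inductions.
\<close>

lemmas fun_pointwise = plus_fun_apply zero_fun_apply minus_apply uminus_apply
declare fun_pointwise [simp del]

lemma dual_add:
  assumes "\<xi> \<in> dual s" "\<eta> \<in> dual s"
  shows "(\<lambda>x. \<xi> x + \<eta> x) \<in> dual s"
  using assms by (auto simp: dual_def Vector_Spaces.linear_iff algebra_simps)

lemma dual_scale:
  assumes "\<xi> \<in> dual s"
  shows "(\<lambda>x. c * \<xi> x) \<in> dual s"
  using assms by (auto simp: dual_def Vector_Spaces.linear_iff algebra_simps)

lemma dual_compose: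
  assumes "\<xi> \<in> dual s'" "Vector_Spaces.linear s s' f"
  shows "\<xi> \<circ> f \<in> dual s"
  using assms by (auto simp: dual_def Vector_Spaces.linear_iff)

lemma tensor_map_in_dual [simp]:
  "\<xi> \<in> dual s \<Longrightarrow> tensor_map s f g u \<xi> = g (u (\<xi> \<circ> f))"
  and tensor_map_not_in_dual [simp]:
  "\<xi> \<notin> dual s \<Longrightarrow> tensor_map s f g u \<xi> = 0"
  by (simp_all add: tensor_map_def)

locale tensor_product =
  V: vector_space sV + W: vector_space sW
  for sV :: "'k::field \<Rightarrow> 'v::ab_group_add \<Rightarrow> 'v" and sW :: "'k \<Rightarrow> 'w::ab_group_add \<Rightarrow> 'w"
begin

sublocale F: vector_space "pt_scale sW :: 'k \<Rightarrow> (('v \<Rightarrow> 'k) \<Rightarrow> 'w) \<Rightarrow> _"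
  by (rule vector_space_pt_scale) (rule W.vector_space_axioms)

lemma pure_tensor_in_tensor_space [simp, intro]: "pure_tensor sV sW v w \<in> tensor_space sV sW"
  unfolding tensor_space_def by (rule F.span_base) blast

lemma tensor_space_add [simp, intro]:
  "u \<in> tensor_space sV sW \<Longrightarrow> v \<in> tensor_space sV sW \<Longrightarrow> u + v \<in> tensor_space sV sW"
  unfolding tensor_space_def by (rule F.span_add)

lemma tensor_space_diff [simp, intro]:
  "u \<in> tensor_space sV sW \<Longrightarrow> v \<in> tensor_space sV sW \<Longrightarrow> u - v \<in> tensor_space sV sW"
  unfolding tensor_space_def by (rule F.span_diff)

lemma tensor_space_sum [intro]:
  "(\<And>j. j \<in> J \<Longrightarrow> f j \<in> tensor_space sV sW) \<Longrightarrow> sum f J \<in> tensor_space sV sW"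
  unfolding tensor_space_def by (rule F.span_sum)

lemma scale_pure_tensor: "pt_scale sW c (pure_tensor sV sW v w) = pure_tensor sV sW v (sW c w)"
  by (auto simp: pt_scale_def pure_tensor_def fun_pointwise fun_eq_iff W.scale_left_commute)

lemma pure_tensor_scale: "pure_tensor sV sW (sV c v) w = pure_tensor sV sW v (sW c w)"
  by (auto simp: dual_def pure_tensor_def fun_pointwise fun_eq_iff Vector_Spaces.linear_iff mult.commute)

lemma pure_tensor_add_right: "pure_tensor sV sW v (w + w') = pure_tensor sV sW v w + pure_tensor sV sW v w'"
  by (auto simp: dual_def pure_tensor_def fun_pointwise fun_eq_iff Vector_Spaces.linear_iff W.scale_right_distrib)

lemma pure_tensor_zero [simp]: "pure_tensor sV sW v 0 = 0"
  by (auto simp: pure_tensor_def fun_pointwise fun_eq_iff)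

lemma tensor_space_induct [consumes 1, case_names pure add]:
  assumes "u \<in> tensor_space sV sW"
    and pure: "\<And>v w. Q (pure_tensor sV sW v w)"
    and add: "\<And>u u'. u \<in> tensor_space sV sW \<Longrightarrow> u' \<in> tensor_space sV sW \<Longrightarrow> Q u \<Longrightarrow> Q u' \<Longrightarrow> Q (u + u')"
  shows "Q u"
proof -
  have "u \<in> tensor_space sV sW \<and> Q u"
    using assms(1) unfolding tensor_space_def
  proof (induction rule: F.span_induct_alt)
    case base
    then show ?case using pure[of 0 0] by (simp add: F.span_zero)
  next
    case (step c x y)
    then obtain v w where "x = pure_tensor sV sW v w" by blast
    then have x: "pt_scale sW c x = pure_tensor sV sW v (sW c w)"
      by (simp add: scale_pure_tensor)
    show ?case
      using step add[of "pt_scale sW c x" y] pure pure_tensor_in_tensor_space tensor_space_add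
      unfolding x tensor_space_def by blast
  qed
  then show ?thesis ..
qed

text \<open>A tensor is linear on the dual, because pure tensors are.\<close>
lemma tensor_space_eval_add:
  assumes "u \<in> tensor_space sV sW" "\<xi> \<in> dual sV" "\<eta> \<in> dual sV"
  shows "u (\<lambda>x. \<xi> x + \<eta> x) = u \<xi> + u \<eta>"
  using assms(1)
  by (induction rule: tensor_space_induct)
    (simp_all add: assms dual_add pure_tensor_def fun_pointwise W.scale_left_distrib algebra_simps)

lemma tensor_space_eval_scale:
  assumes "u \<in> tensor_space sV sW" "\<xi> \<in> dual sV"
  shows "u (\<lambda>x. c * \<xi> x) = sW c (u \<xi>)"
  using assms(1)
  by (induction rule: tensor_space_induct)
    (simp_all add: assms dual_scale pure_tensor_def fun_pointwise W.scale_right_distrib)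

lemma tensor_space_eval_outside:
  assumes "u \<in> tensor_space sV sW" "\<xi> \<notin> dual sV"
  shows "u \<xi> = 0"
  using assms(1)
  by (induction rule: tensor_space_induct) (simp_all add: assms pure_tensor_def fun_pointwise)

end

lemma tensor_map_add:
  fixes g :: "'w1::ab_group_add \<Rightarrow> 'w2::ab_group_add"
  assumes "\<And>x y. g (x + y) = g x + g y"
  shows "tensor_map s f g (u + u') = tensor_map s f g u + tensor_map s f g u'"
proof -
  have "g (x + y) = g x + g y" for x y by (rule assms)
  then show ?thesis by (auto simp: tensor_map_def fun_eq_iff fun_pointwise)
qed

lemma tensor_map_in_tensor_space:
  assumes f: "Vector_Spaces.linear sV sV' f" and g: "Vector_Spaces.linear sW sW' g"
    and u: "u \<in> tensor_space sV sW"
  shows "tensor_map sV' f g u \<in> tensor_space sV' sW'"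
proof -
  interpret f: Vector_Spaces.linear sV sV' f by fact
  interpret g: Vector_Spaces.linear sW sW' g by fact
  interpret T: tensor_product sV sW ..
  interpret T': tensor_product sV' sW' ..
  show ?thesis using u
    by (induction rule: T.tensor_space_induct)
      (auto simp: tensor_map_pure[OF f g] tensor_map_add[of g] g.add)
qed

lemma tensor_map_compose:
  assumes "Vector_Spaces.linear sV' sV'' f'"
  shows "tensor_map sV'' f' g' (tensor_map sV' f g u) = tensor_map sV'' (f' \<circ> f) (g' \<circ> g) u"
  using assms by (auto simp: fun_eq_iff tensor_map_def dual_compose o_assoc)

section \<open>Base change\<close>

locale hom_leibniz_structure =
  fixes L :: "('k::field, 'l::ab_group_add) hom_algebra"
  assumes hom_leibniz_algebra: "hom_leibniz_algebra L"
begin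

sublocale W: vector_space "lscale L"
  using hom_leibniz_algebra by (simp add: hom_leibniz_algebra_def)

lemma bracket_simps [simp]:
  "lbracket L (x + y) z = lbracket L x z + lbracket L y z"
  "lbracket L x (y + z) = lbracket L x y + lbracket L x z"
  "lbracket L (lscale L c x) y = lscale L c (lbracket L x y)"
  "lbracket L x (lscale L c y) = lscale L c (lbracket L x y)"
  using hom_leibniz_algebra
  by (simp_all add: hom_leibniz_algebra_def hom_leibniz_def bilinear_operation_def)

lemma twist_simps [simp]:
  "ltwist L (x + y) = ltwist L x + ltwist L y"
  "ltwist L (lscale L c x) = lscale L c (ltwist L x)"
  "ltwist L (lbracket L x y) = lbracket L (ltwist L x) (ltwist L y)"
  using hom_leibniz_algebra
  by (simp_all add: hom_leibniz_algebra_def hom_leibniz_def)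

lemma linear_twist: "Vector_Spaces.linear (lscale L) (lscale L) (ltwist L)"
  using W.vector_space_axioms by (simp add: Vector_Spaces.linear_iff)

lemma bracket_diff:
  "lbracket L (x - y) z = lbracket L x z - lbracket L y z"
  "lbracket L x (y - z) = lbracket L x y - lbracket L x z"
  using bracket_simps(1)[of "x - y" y z] bracket_simps(2)[of x "y - z" z] by (simp_all add: algebra_simps del: bracket_simps)

lemma twist_diff: "ltwist L (x - y) = ltwist L x - ltwist L y"
  using twist_simps(1)[of "x - y" y] by (simp add: algebra_simps del: twist_simps)

end

text \<open>
  The module \<open>T = A \<otimes> L\<close> with the action \<open>act\<close> of \<open>A\<close>, the twist \<open>tw\<close> and the map
  \<open>ctr = \<epsilon> \<otimes> id\<close> onto \<open>L\<close>. It is generated over \<open>A\<close> by the elements \<open>unit_tensor x = 1 \<otimes> x\<close>.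
\<close>
locale base_change_module = hom_leibniz_structure L
  for A :: "('k::field, 'a::ab_group_add) aug_algebra"
    and L :: "('k, 'l::ab_group_add) hom_algebra" +
  assumes augmented_algebra: "augmented_algebra A"
begin

sublocale R: comm_ring_1 "amult A" "aone A" "(+)" 0 "(-)" uminus
  using augmented_algebra by (simp add: augmented_algebra_def)

sublocale tensor_product "ascale A" "lscale L"
  using augmented_algebra W.vector_space_axioms
  unfolding augmented_algebra_def tensor_product_def by simp

lemma amult_scale: "amult A (ascale A c a) b = ascale A c (amult A a b)"
  using augmented_algebra by (simp add: augmented_algebra_def)

lemma linear_amult: "Vector_Spaces.linear (ascale A) (ascale A) (amult A a)"
  using amult_scale[of _ _ a] V.vector_space_axioms
  by (simp add: Vector_Spaces.linear_iff R.distrib_left R.mult.commute)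

lemma aug_dual [simp, intro]: "aug A \<in> dual (ascale A)"
  using augmented_algebra by (simp add: augmented_algebra_def dual_def)

lemma aug_simps [simp]:
  "aug A (a + b) = aug A a + aug A b" "aug A (ascale A c a) = c * aug A a"
  "aug A (amult A a b) = aug A a * aug A b" "aug A (aone A) = 1"
  using augmented_algebra by (simp_all add: augmented_algebra_def Vector_Spaces.linear_iff)

lemma linear_ids:
  "Vector_Spaces.linear (ascale A) (ascale A) id" "Vector_Spaces.linear (lscale L) (lscale L) id"
  using V.vector_space_axioms W.vector_space_axioms by (simp_all add: Vector_Spaces.linear_iff)

abbreviation "T \<equiv> base_change A L"
abbreviation "act \<equiv> base_action A :: 'a \<Rightarrow> ('k, 'a, 'l) tensor \<Rightarrow> _"
abbreviation "tw \<equiv> base_twist A L"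
abbreviation "unit_tensor \<equiv> tensor A L (aone A)"
abbreviation "ctr \<equiv> contraction (aug A) :: ('k, 'a, 'l) tensor \<Rightarrow> 'l"

lemma act_pure: "act a (tensor A L b x) = tensor A L (amult A a b) x"
  unfolding base_action_def by (subst tensor_map_pure[OF linear_amult linear_ids(2)]) simp

lemma pure_eq_act: "tensor A L a x = act a (unit_tensor x)"
  by (simp add: act_pure)

lemma act_in [simp, intro]: "u \<in> T \<Longrightarrow> act a u \<in> T"
  unfolding base_action_def by (rule tensor_map_in_tensor_space[OF linear_amult linear_ids(2)])

lemma act_add: "act a (u + v) = act a u + act a v"
  unfolding base_action_def by (simp add: tensor_map_add)

lemma act_add_left:
  assumes "u \<in> T" shows "act (a + b) u = act a u + act b u"
proof
  fix \<xi>
  show "act (a + b) u \<xi> = (act a u + act b u) \<xi>"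
  proof (cases "\<xi> \<in> dual (ascale A)")
    case True
    then have "\<xi> \<circ> amult A (a + b) = (\<lambda>x. (\<xi> \<circ> amult A a) x + (\<xi> \<circ> amult A b) x)"
      by (auto simp: dual_def Vector_Spaces.linear_iff R.distrib_right)
    then show ?thesis
      using True tensor_space_eval_add[OF assms dual_compose[OF True linear_amult] dual_compose[OF True linear_amult]]
      by (simp add: base_action_def fun_pointwise)
  qed (simp add: base_action_def fun_pointwise)
qed

lemma act_act: "act a (act b u) = act (amult A a b) u"
proof -
  have "amult A a \<circ> amult A b = amult A (amult A a b)"
    by (simp add: fun_eq_iff R.mult.assoc)
  then show ?thesis
    unfolding base_action_def by (simp add: tensor_map_compose[OF linear_amult])
qed

lemma act_left_commute: "act a (act b u) = act b (act a u)"
  by (simp add: act_act R.mult.commute)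

lemma act_diff: "act a (u - v) = act a u - act a v"
  using act_add[of a "u - v" v] by (simp add: algebra_simps)

lemma base_change_induct [consumes 1, case_names act add]:
  assumes "u \<in> T"
    and "\<And>a x. Q (act a (unit_tensor x))"
    and "\<And>u v. u \<in> T \<Longrightarrow> v \<in> T \<Longrightarrow> Q u \<Longrightarrow> Q v \<Longrightarrow> Q (u + v)"
  shows "Q u"
  using assms by (induction rule: tensor_space_induct) (auto simp: pure_eq_act[symmetric])

lemma unit_tensor_scale: "unit_tensor (lscale L c x) = act (ascale A c (aone A)) (unit_tensor x)"
  by (simp add: act_pure pure_tensor_scale)

lemma tw_pure: "tw (tensor A L a x) = tensor A L a (ltwist L x)"
  unfolding base_twist_def by (subst tensor_map_pure[OF linear_ids(1) linear_twist]) simp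

lemma tw_in [simp, intro]: "u \<in> T \<Longrightarrow> tw u \<in> T"
  unfolding base_twist_def by (rule tensor_map_in_tensor_space[OF linear_ids(1) linear_twist])

lemma tw_add: "tw (u + v) = tw u + tw v"
  unfolding base_twist_def by (simp add: tensor_map_add)

lemma tw_act: "tw (act a u) = act a (tw u)"
  unfolding base_action_def base_twist_def
  by (simp add: tensor_map_compose[OF linear_ids(1)] tensor_map_compose[OF linear_amult])

lemma ctr_add [simp]: "ctr (u + v) = ctr u + ctr v"
  by (simp add: contraction_def fun_pointwise)

lemma ctr_unit [simp]: "ctr (unit_tensor x) = x"
  by (simp add: contraction_pure)

lemma ctr_act [simp]:
  assumes "u \<in> T" shows "ctr (act a u) = lscale L (aug A a) (ctr u)"
proof -
  have "aug A \<circ> amult A a = (\<lambda>b. aug A a * aug A b)" by auto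
  then show ?thesis
    using tensor_space_eval_scale[OF assms aug_dual] by (simp add: contraction_def base_action_def)
qed

lemma ctr_tw [simp]: "ctr (tw u) = ltwist L (ctr u)"
  by (simp add: contraction_def base_twist_def)

end

section \<open>Extending operations bilinearly over the base\<close>

context base_change_module begin

lemma scale_eq_act:
  assumes "u \<in> T" shows "act (ascale A c (aone A)) u = pt_scale (lscale L) c u"
  using assms
  by (induction rule: tensor_space_induct)
    (simp_all add: act_add act_pure pure_tensor_scale scale_pure_tensor F.scale_right_distrib amult_scale)

lemma act_one: "u \<in> T \<Longrightarrow> act (aone A) u = u"
  by (induction rule: tensor_space_induct) (simp_all add: act_add act_pure)

lemma act_scale_left: "u \<in> T \<Longrightarrow> act (ascale A c a) u = act a (pt_scale (lscale L) c u)"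
  using amult_scale[of c "aone A" a]
  by (simp add: scale_eq_act[symmetric] act_act R.mult.commute[of a])

lemma act_zero_left: "u \<in> T \<Longrightarrow> act 0 u = 0"
  using act_add_left[of u 0 0] by simp

lemma act_sum_left: "u \<in> T \<Longrightarrow> act (\<Sum>j\<in>J. f j) u = (\<Sum>j\<in>J. act (f j) u)"
  by (induction J rule: infinite_finite_induct) (simp_all add: act_zero_left act_add_left)

lemma tw_zero [simp]: "tw 0 = 0"
  using tw_add[of 0 0] by simp

lemma tw_sum: "tw (sum f J) = (\<Sum>j\<in>J. tw (f j))"
  by (induction J rule: infinite_finite_induct) (simp_all add: tw_add)

lemma tw_diff: "tw (u - v) = tw u - tw v"
  using tw_add[of "u - v" v] by (simp add: algebra_simps)

text \<open>
  A bilinear map \<open>m\<close> on \<open>L\<close> with values in \<open>A \<otimes> L\<close> is extended by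
  \<open>{a \<otimes> x, b \<otimes> y} = a b m(x, y)\<close>. With a finite basis of \<open>A\<close>, every tensor \<open>u\<close> is the sum of the
  \<open>b \<otimes> u(b\<^sup>*)\<close> over the basis, \<open>b\<^sup>*\<close> being the coordinate forms. This turns the prescription into an
  explicit formula, whose well-definedness is not an issue.
\<close>
lemma bilinear_extension:
  assumes fin: "finite_dimensional_algebra A"
    and m_in: "\<And>x y. m x y \<in> T"
    and m_add: "\<And>x x' y. m (x + x') y = m x y + m x' y" "\<And>x y y'. m x (y + y') = m x y + m x y'"
    and m_scale: "\<And>c x y. m (lscale L c x) y = pt_scale (lscale L) c (m x y)"
      "\<And>c x y. m x (lscale L c y) = pt_scale (lscale L) c (m x y)"
    and m_tw: "\<And>x y. tw (m x y) = m (ltwist L x) (ltwist L y)"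
  shows "\<exists>br. bilinear_operation act T br \<and> (\<forall>x y. br (unit_tensor x) (unit_tensor y) = m x y) \<and>
    (\<forall>u\<in>T. \<forall>v\<in>T. tw (br u v) = br (tw u) (tw v))"
proof -
  obtain Bas where Bas: "finite_dimensional_vector_space (ascale A) Bas"
    using fin by (auto simp: finite_dimensional_algebra_def)
  interpret FV: finite_dimensional_vector_space "ascale A" Bas by fact
  define r where "r b = (\<lambda>v. V.representation Bas v b)" for b
  have r: "r b \<in> dual (ascale A)" for b
    unfolding dual_def r_def
    using V.linear_representation[OF FV.independent_Basis FV.span_Basis] by simp
  have expand: "(\<Sum>b\<in>Bas. ascale A (r b v) b) = v" for v
    unfolding r_def
    by (rule V.sum_representation_eq)
      (auto simp: FV.independent_Basis FV.span_Basis FV.finite_Basis)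
  define br where "br u v = (\<Sum>b\<in>Bas. act b (\<Sum>b'\<in>Bas. act b' (m (u (r b)) (v (r b')))))" for u v
  \<comment> \<open>The one-variable case: summing over the basis recovers the value at a pure tensor.\<close>
  have collect: "(\<Sum>b\<in>Bas. act b (g (tensor A L a x (r b)))) = act a (g x)"
    if "\<And>x. g x \<in> T" "\<And>c x. g (lscale L c x) = pt_scale (lscale L) c (g x)" for g a x
  proof -
    have "(\<Sum>b\<in>Bas. act b (g (tensor A L a x (r b)))) = (\<Sum>b\<in>Bas. act (ascale A (r b a) b) (g x))"
      using r that by (simp add: pure_tensor_def act_scale_left)
    also have "\<dots> = act (\<Sum>b\<in>Bas. ascale A (r b a) b) (g x)"
      using that by (simp add: act_sum_left)
    finally show ?thesis by (simp add: expand)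
  qed
  have add_left: "br (u + u') v = br u v + br u' v" for u u' v
    by (simp add: br_def m_add act_add sum.distrib fun_pointwise)
  have add_right: "br u (v + v') = br u v + br u v'" for u v v'
    by (simp add: br_def m_add act_add sum.distrib fun_pointwise)
  have br_gen: "br (tensor A L a x) (tensor A L a' y) = act a (act a' (m x y))" for a a' x y
  proof -
    have "br (tensor A L a x) (tensor A L a' y)
        = (\<Sum>b\<in>Bas. act b (act a' (m (tensor A L a x (r b)) y)))"
      unfolding br_def by (simp add: collect[of "\<lambda>y. m _ y"] m_in m_scale)
    also have "\<dots> = act a (act a' (m x y))"
      by (rule collect) (simp_all add: m_in m_scale scale_eq_act[symmetric] act_left_commute[of a'])
    finally show ?thesis .
  qed
  have act_left: "br (act c u) v = act c (br u v)" if "u \<in> T" "v \<in> T" for c u v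
    using that(1)
  proof (induction rule: tensor_space_induct)
    case (pure a x)
    show ?case using that(2)
      by (induction rule: tensor_space_induct) (simp_all add: act_pure br_gen act_act add_right act_add R.mult.assoc)
  qed (simp add: act_add add_left)
  have act_right: "br u (act c v) = act c (br u v)" if "u \<in> T" "v \<in> T" for c u v
    using that(1)
  proof (induction rule: tensor_space_induct)
    case (pure a x)
    show ?case using that(2)
      by (induction rule: tensor_space_induct)
        (simp_all add: act_pure br_gen act_act add_right act_add R.mult.left_commute R.mult.assoc)
  qed (simp add: act_add add_left)
  have "br u v \<in> T" for u v
    unfolding br_def by (intro tensor_space_sum act_in m_in)
  then have "bilinear_operation act T br"
    by (simp add: bilinear_operation_def add_left add_right act_left act_right)
  moreover have "br (unit_tensor x) (unit_tensor y) = m x y" for x y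
    by (simp add: br_gen act_one m_in)
  moreover have "tw (br u v) = br (tw u) (tw v)" for u v
    by (simp add: br_def tw_sum tw_act m_tw) (simp add: base_twist_def r)
  ultimately show ?thesis by blast
qed

end

section \<open>The Leibniz defect\<close>

definition leibniz_defect ::
  "('v \<Rightarrow> 'v) \<Rightarrow> ('v \<Rightarrow> 'v \<Rightarrow> 'v) \<Rightarrow> 'v::ab_group_add \<Rightarrow> 'v \<Rightarrow> 'v \<Rightarrow> 'v" where
  "leibniz_defect \<alpha> br u v w =
     br (\<alpha> u) (br v w) - br (br u v) (\<alpha> w) + br (br u w) (\<alpha> v)"

locale twisted_operation = base_change_module A L
  for A :: "('k::field, 'a::ab_group_add) aug_algebra"
    and L :: "('k, 'l::ab_group_add) hom_algebra" +
  fixes br :: "('k, 'a, 'l) tensor \<Rightarrow> ('k, 'a, 'l) tensor \<Rightarrow> ('k, 'a, 'l) tensor"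
  assumes bilinear: "bilinear_operation act T br"
    and tw_br: "\<And>u v. u \<in> T \<Longrightarrow> v \<in> T \<Longrightarrow> tw (br u v) = br (tw u) (tw v)"
begin

lemma br_in [simp, intro]: "u \<in> T \<Longrightarrow> v \<in> T \<Longrightarrow> br u v \<in> T"
  and br_add_left: "u \<in> T \<Longrightarrow> v \<in> T \<Longrightarrow> w \<in> T \<Longrightarrow> br (u + v) w = br u w + br v w"
  and br_add_right: "u \<in> T \<Longrightarrow> v \<in> T \<Longrightarrow> w \<in> T \<Longrightarrow> br u (v + w) = br u v + br u w"
  and br_act_left: "u \<in> T \<Longrightarrow> v \<in> T \<Longrightarrow> br (act a u) v = act a (br u v)"
  and br_act_right: "u \<in> T \<Longrightarrow> v \<in> T \<Longrightarrow> br u (act a v) = act a (br u v)"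
  using bilinear by (simp_all add: bilinear_operation_def)

lemma br_diff_left: "u \<in> T \<Longrightarrow> v \<in> T \<Longrightarrow> w \<in> T \<Longrightarrow> br (u - v) w = br u w - br v w"
  using br_add_left[of "u - v" v w] by (simp add: algebra_simps)

lemma br_diff_right: "u \<in> T \<Longrightarrow> v \<in> T \<Longrightarrow> w \<in> T \<Longrightarrow> br u (v - w) = br u v - br u w"
  using br_add_right[of u "v - w" w] by (simp add: algebra_simps)

abbreviation "defect \<equiv> leibniz_defect tw br"

lemma defect_in [simp, intro]: "u \<in> T \<Longrightarrow> v \<in> T \<Longrightarrow> w \<in> T \<Longrightarrow> defect u v w \<in> T"
  by (simp add: leibniz_defect_def)

lemma defect_add:
  assumes "u \<in> T" "v \<in> T" "w \<in> T" "w' \<in> T"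
  shows "defect (w + w') u v = defect w u v + defect w' u v"
    and "defect u (w + w') v = defect u w v + defect u w' v"
    and "defect u v (w + w') = defect u v w + defect u v w'"
  using assms by (simp_all add: leibniz_defect_def tw_add br_add_left br_add_right)

lemma defect_act:
  assumes "u \<in> T" "v \<in> T" "w \<in> T"
  shows "defect (act a u) v w = act a (defect u v w)"
    and "defect u (act a v) w = act a (defect u v w)"
    and "defect u v (act a w) = act a (defect u v w)"
  using assms
  by (simp_all add: leibniz_defect_def tw_act br_act_left br_act_right act_add act_diff)

lemma tw_defect:
  assumes "u \<in> T" "v \<in> T" "w \<in> T"
  shows "tw (defect u v w) = defect (tw u) (tw v) (tw w)"
  using assms by (simp add: leibniz_defect_def tw_add tw_diff tw_br)

text \<open>
  The analogue of the Bianchi identity: when the twist is moved inside the brackets by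
  multiplicativity, every term \<open>{{x, y}, {z, w}}\<close>, \<open>{x, {y, {z, w}}}\<close>, and so on, occurs
  twice with opposite signs.
\<close>
lemma defect_cocycle_identity:
  assumes "x1 \<in> T" "x2 \<in> T" "x3 \<in> T" "x4 \<in> T"
  shows "br (tw (tw x1)) (defect x2 x3 x4) + br (defect x1 x3 x4) (tw (tw x2))
      - br (defect x1 x2 x4) (tw (tw x3)) + br (defect x1 x2 x3) (tw (tw x4))
      - defect (br x1 x2) (tw x3) (tw x4) + defect (br x1 x3) (tw x2) (tw x4)
      - defect (br x1 x4) (tw x2) (tw x3) + defect (tw x1) (br x2 x3) (tw x4)
      - defect (tw x1) (br x2 x4) (tw x3) - defect (tw x1) (tw x2) (br x3 x4) = 0"
  using assms
  by (simp add: leibniz_defect_def tw_br br_add_left br_add_right br_diff_left br_diff_right)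

end

section \<open>One-dimensional extensions after base change\<close>

text \<open>
  A homomorphism \<open>h : B \<rightarrow> A\<close> induces \<open>h \<otimes> id : B \<otimes> L \<rightarrow> A \<otimes> L\<close>, which is semilinear over \<open>h\<close>. This is
  applied to the projection of an extension and to isomorphisms of extensions.
\<close>
lemma push_act:
  assumes "base_change_module A L" "algebra_hom B A h"
  shows "tensor_map (ascale A) h id (base_action B b u)
    = base_action A (h b) (tensor_map (ascale A) h id (u :: ('k::field, 'b::ab_group_add, 'l::ab_group_add) tensor))"
proof -
  interpret A: base_change_module A L by fact
  have lin: "Vector_Spaces.linear (ascale B) (ascale A) h"
    and hom: "h (amult B x y) = amult A (h x) (h y)" for x y
    using assms(2) by (simp_all add: algebra_hom_def)
  have "h \<circ> amult B b = amult A (h b) \<circ> h"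
    by (simp add: fun_eq_iff hom)
  then show ?thesis
    unfolding base_action_def
    by (simp add: tensor_map_compose[OF lin] tensor_map_compose[OF A.linear_amult])
qed

lemma push_tw:
  assumes "base_change_module A L" "base_change_module B L" "Vector_Spaces.linear (ascale B) (ascale A) h"
  shows "tensor_map (ascale A) h id (base_twist B L u) = base_twist A L (tensor_map (ascale A) h id u)"
proof -
  interpret A: base_change_module A L by fact
  interpret B: base_change_module B L by fact
  show ?thesis
    unfolding base_twist_def
    by (simp add: tensor_map_compose[OF assms(3)] tensor_map_compose[OF A.linear_ids(1)])
qed

lemma push_pure:
  assumes "base_change_module A L" "Vector_Spaces.linear (ascale B) (ascale A) h"
  shows "tensor_map (ascale A) h id (tensor B L b x) = tensor A L (h b) x"
proof -
  interpret A: base_change_module A L by fact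
  show ?thesis by (subst tensor_map_pure[OF assms(2) A.linear_ids(2)]) simp
qed

locale extension_base_change = A: base_change_module A L + B: base_change_module B L
  for A :: "('k::field, 'a::ab_group_add) aug_algebra"
    and B :: "('k, 'b::ab_group_add) aug_algebra"
    and L :: "('k, 'l::ab_group_add) hom_algebra" +
  fixes i :: "'k \<Rightarrow> 'b" and p :: "'b \<Rightarrow> 'a"
  assumes extension: "extension A B i p"
begin

abbreviation "P \<equiv> tensor_map (ascale A) p id :: ('k, 'b, 'l) tensor \<Rightarrow> _"
abbreviation "I \<equiv> tensor B L (i 1)"

lemma p_hom: "algebra_hom B A p"
  and linear_p: "Vector_Spaces.linear (ascale B) (ascale A) p"
  and linear_i: "Vector_Spaces.linear (*) (ascale B) i"
  and aug_B: "aug B = aug A \<circ> p"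
  and surj_p: "surj p"
  and inj_i: "inj i"
  and kernel_p: "range i = {b. p b = 0}"
  and i_mult_aug: "amult B (i k) b = i (aug A (p b) * k)"
  using extension by (simp_all add: extension_def algebra_hom_def)

lemma p_simps [simp]:
  "p (b + b') = p b + p b'" "p (ascale B c b) = ascale A c (p b)"
  "p (amult B b b') = amult A (p b) (p b')" "p (aone B) = aone A"
  using p_hom by (simp_all add: algebra_hom_def Vector_Spaces.linear_iff)

lemma p_i [simp]: "p (i k) = 0"
  using kernel_p by auto

lemma i_scale: "i k = ascale B k (i 1)"
proof -
  have "i (k * 1) = ascale B k (i 1)"
    using linear_i unfolding Vector_Spaces.linear_iff by blast
  then show ?thesis by simp
qed

lemma aug_p: "aug A (p b) = aug B b"
  by (simp add: aug_B)

lemma i_mult: "amult B (i k) b = ascale B (aug B b) (i k)"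
proof -
  have "amult B (i k) b = i (aug B b * k)"
    by (simp add: i_mult_aug aug_p)
  also have "\<dots> = ascale B (aug B b) (i k)"
    by (simp add: i_scale[of "aug B b * k"] i_scale[of k])
  finally show ?thesis .
qed

text \<open>
  As a vector space, \<open>B\<close> is the direct sum of \<open>A\<close> and the ground field; \<open>\<kappa>\<close> is the coordinate
  along \<open>i\<close>.
\<close>
lemma splitting:
  obtains \<sigma> \<kappa> where "Vector_Spaces.linear (ascale A) (ascale B) \<sigma>" "\<kappa> \<in> dual (ascale B)"
    "p \<circ> \<sigma> = id" "\<And>b. b = \<sigma> (p b) + i (\<kappa> b)" "\<And>k. \<kappa> (i k) = k"
proof -
  interpret AB: vector_space_pair "ascale B" "ascale A" ..
  obtain \<sigma> where \<sigma>: "Vector_Spaces.linear (ascale A) (ascale B) \<sigma>" "p \<circ> \<sigma> = id"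
    using AB.linear_surjective_right_inverse[OF linear_p surj_p] by blast
  interpret \<sigma>: Vector_Spaces.linear "ascale A" "ascale B" \<sigma> by fact
  interpret i: Vector_Spaces.linear "(*)" "ascale B" i by (rule linear_i)
  interpret p: Vector_Spaces.linear "ascale B" "ascale A" p by (rule linear_p)
  have p\<sigma>: "p (\<sigma> a) = a" for a
    using \<sigma>(2) by (simp add: fun_eq_iff)
  have inj: "i k = i k' \<Longrightarrow> k = k'" for k k'
    using inj_i by (simp add: inj_eq)
  have "\<exists>k. i k = b - \<sigma> (p b)" for b
  proof -
    have "p (b - \<sigma> (p b)) = 0"
      by (simp add: p.diff p\<sigma>)
    then have "b - \<sigma> (p b) \<in> range i"
      by (simp add: kernel_p)
    then show ?thesis by auto
  qed
  then obtain \<kappa> where \<kappa>: "i (\<kappa> b) = b - \<sigma> (p b)" for b by metis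
  have "\<kappa> (b + b') = \<kappa> b + \<kappa> b'" for b b'
    by (rule inj) (simp add: i.add \<kappa> \<sigma>.add algebra_simps)
  moreover have "\<kappa> (ascale B c b) = c * \<kappa> b" for b c
    by (rule inj) (simp add: i.scale \<kappa> \<sigma>.scale B.V.scale_right_diff_distrib)
  ultimately have "\<kappa> \<in> dual (ascale B)"
    using B.V.vector_space_axioms i.vs1.vector_space_axioms
    by (simp add: dual_def Vector_Spaces.linear_iff)
  moreover have "\<kappa> (i k) = k" for k
    by (rule inj) (simp add: \<kappa> \<sigma>.zero)
  moreover have "b = \<sigma> (p b) + i (\<kappa> b)" for b
    by (simp add: \<kappa>)
  ultimately show thesis
    by (intro that[OF \<sigma>(1) _ \<sigma>(2)])
qed

lemma P_simps [simp]:
  "P (u + v) = P u + P v" "P (u - v) = P u - P v" "P 0 = 0"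
  "P (B.act b u) = A.act (p b) (P u)" "P (B.tw u) = A.tw (P u)" "P (B.unit_tensor x) = A.unit_tensor x"
  and P_in [intro, simp]: "u \<in> B.T \<Longrightarrow> P u \<in> A.T"
proof -
  show add: "P (u + v) = P u + P v" for u v by (simp add: tensor_map_add)
  show "P (u - v) = P u - P v" using add[of "u - v" v] by (simp add: algebra_simps)
  show "P 0 = 0" using add[of 0 0] by simp
  show "P (B.act b u) = A.act (p b) (P u)"
    by (rule push_act[OF A.base_change_module_axioms p_hom])
  show "P (B.tw u) = A.tw (P u)"
    by (rule push_tw[OF A.base_change_module_axioms B.base_change_module_axioms linear_p])
  show "P (B.unit_tensor x) = A.unit_tensor x"
    by (simp add: push_pure[OF A.base_change_module_axioms linear_p])
  show "P u \<in> A.T" if "u \<in> B.T"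
    using that by (rule tensor_map_in_tensor_space[OF linear_p A.linear_ids(2)])
qed

lemma ctr_P: "A.ctr (P u) = B.ctr u"
  by (simp add: contraction_def aug_B)

lemma I_eq_act: "I x = B.act (i 1) (B.unit_tensor x)"
  by (rule B.pure_eq_act)

lemma P_I [simp]: "P (I x) = 0"
  by (simp add: I_eq_act A.act_zero_left)

lemma ctr_I [simp]: "B.ctr (I x) = 0"
  using ctr_P[of "I x"] by (simp add: contraction_def fun_pointwise)

lemma I_add: "I (x + y) = I x + I y"
  by (rule B.pure_tensor_add_right)

lemma I_inj: "I x = I y \<longleftrightarrow> x = y"
proof
  assume eq: "I x = I y"
  obtain \<kappa> where "\<kappa> \<in> dual (ascale B)" "\<kappa> (i 1) = 1" using splitting by metis
  then show "x = y" using fun_cong[OF eq, of \<kappa>] by (simp add: pure_tensor_def)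
qed simp

lemma I_zero [simp]: "I 0 = 0"
  by (rule B.pure_tensor_zero)

lemma I_diff: "I (x - y) = I x - I y"
  using I_add[of "x - y" y] by (simp add: algebra_simps)

lemma act_I: "B.act b (I x) = I (lscale L (aug B b) x)"
  by (simp add: B.act_pure B.R.mult.commute[of b] i_mult B.pure_tensor_scale)

text \<open>
  Multiplication by \<open>i(1)\<close> annihilates the kernel of the augmentation, so on \<open>B \<otimes> L\<close> it only sees
  the contraction.
\<close>
lemma act_i:
  assumes "u \<in> B.T" shows "B.act (i 1) u = I (B.ctr u)"
  using assms
proof (induction rule: B.base_change_induct)
  case (act a x)
  have "B.act (i 1) (B.act a (B.unit_tensor x)) = B.act a (I x)"
    unfolding I_eq_act by (rule B.act_left_commute)
  then show ?case by (simp add: act_I)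
qed (simp add: B.act_add I_add)

text \<open>
  Evaluation at the coordinate form \<open>\<kappa>\<close> reads off the preimage: every form \<open>\<xi>\<close> on \<open>B\<close> is
  \<open>\<xi> \<circ> \<sigma> \<circ> p + \<xi>(i 1) \<kappa>\<close>, and an element of the kernel of \<open>P\<close> vanishes on forms that factor
  through \<open>p\<close>.
\<close>
lemma kernel_P:
  assumes "u \<in> B.T" "P u = 0"
  obtains x where "u = I x"
proof -
  obtain \<sigma> \<kappa> where \<sigma>: "Vector_Spaces.linear (ascale A) (ascale B) \<sigma>" and \<kappa>: "\<kappa> \<in> dual (ascale B)"
    and split: "\<And>b. b = \<sigma> (p b) + i (\<kappa> b)" by (rule splitting) (rule that)
  have "u \<xi> = I (u \<kappa>) \<xi>" for \<xi>
  proof (cases "\<xi> \<in> dual (ascale B)")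
    case True
    define \<eta> where "\<eta> = \<xi> \<circ> \<sigma>"
    have \<eta>: "\<eta> \<in> dual (ascale A)" unfolding \<eta>_def by (rule dual_compose[OF True \<sigma>])
    have "\<xi> b = \<eta> (p b) + \<xi> (i 1) * \<kappa> b" for b
    proof -
      have "\<xi> b = \<xi> (\<sigma> (p b) + ascale B (\<kappa> b) (i 1))"
        by (rule arg_cong[of _ _ \<xi>]) (use split[of b] in \<open>simp only: i_scale[of "\<kappa> b", symmetric]\<close>)
      also have "\<dots> = \<xi> (\<sigma> (p b)) + \<kappa> b * \<xi> (i 1)"
        using True by (simp add: dual_def Vector_Spaces.linear_iff)
      finally show ?thesis by (simp add: \<eta>_def mult.commute)
    qed
    then have "\<xi> = (\<lambda>b. (\<eta> \<circ> p) b + \<xi> (i 1) * \<kappa> b)" unfolding o_def by (rule ext)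
    then have "u \<xi> = u (\<lambda>b. (\<eta> \<circ> p) b + \<xi> (i 1) * \<kappa> b)" by (rule arg_cong)
    also have "\<dots> = u (\<eta> \<circ> p) + lscale L (\<xi> (i 1)) (u \<kappa>)"
      unfolding B.tensor_space_eval_add[OF assms(1) dual_compose[OF \<eta> linear_p] dual_scale[OF \<kappa>]]
        B.tensor_space_eval_scale[OF assms(1) \<kappa>] ..
    also have "u (\<eta> \<circ> p) = P u \<eta>" by (simp add: \<eta>)
    finally show ?thesis using True assms(2) by (simp add: pure_tensor_def fun_pointwise)
  next
    case False
    then show ?thesis using assms(1) by (simp add: B.tensor_space_eval_outside pure_tensor_def)
  qed
  then show thesis using that by blast
qed

text \<open>
  A \<open>B\<close>-linear map is determined by its values on the generators \<open>1 \<otimes> x\<close>; if these lie in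
  \<open>I L\<close>, then the coefficient \<open>b\<close> of \<open>b (1 \<otimes> x)\<close> acts on them only through \<open>\<epsilon>(b)\<close>.
\<close>
lemma base_linear_factors:
  assumes add: "\<And>u v. u \<in> B.T \<Longrightarrow> v \<in> B.T \<Longrightarrow> G (u + v) = G u + G v"
    and act: "\<And>b u. u \<in> B.T \<Longrightarrow> G (B.act b u) = B.act b (G u)"
    and unit: "\<And>x. G (B.unit_tensor x) = I (g x)"
    and g: "\<And>x y. g (x + y) = g x + g y" "\<And>c x. g (lscale L c x) = lscale L c (g x)"
    and u: "u \<in> B.T"
  shows "G u = I (g (B.ctr u))"
  using u
proof (induction rule: B.base_change_induct)
  case (act b x)
  show ?case by (simp add: assms(2) unit act_I g)
qed (simp add: add g I_add)

end

section \<open>Lifting a deformation\<close>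

locale deformation_extension = extension_base_change A B L i p
  for A :: "('k::field, 'a::ab_group_add) aug_algebra"
    and B :: "('k, 'b::ab_group_add) aug_algebra"
    and L :: "('k, 'l::ab_group_add) hom_algebra"
    and i p +
  fixes lam :: "('k, 'a, 'l) tensor \<Rightarrow> ('k, 'a, 'l) tensor \<Rightarrow> ('k, 'a, 'l) tensor"
  assumes deformation: "deformation A L lam"
begin

sublocale lam: twisted_operation A L lam
  using deformation
  by unfold_locales (simp_all add: deformation_def hom_leibniz_def)

lemma lam_defect: "u \<in> A.T \<Longrightarrow> v \<in> A.T \<Longrightarrow> w \<in> A.T \<Longrightarrow> lam.defect u v w = 0"
  using deformation by (simp add: deformation_def hom_leibniz_def leibniz_defect_def)

text \<open>
  The augmentation condition on a deformation, stated for the generators, extends to all tensors by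
  bilinearity.
\<close>
lemma ctr_lam:
  assumes "u \<in> A.T" "v \<in> A.T"
  shows "A.ctr (lam u v) = lbracket L (A.ctr u) (A.ctr v)"
  using assms(1)
proof (induction rule: A.base_change_induct)
  case (act a x)
  show ?case using assms(2)
  proof (induction rule: A.base_change_induct)
    case (act b y)
    have "A.ctr (lam (A.unit_tensor x) (A.unit_tensor y)) = lbracket L x y"
      using deformation by (simp add: deformation_def)
    then show ?case by (simp add: lam.br_act_left lam.br_act_right mult.commute)
  qed (simp add: lam.br_add_right)
qed (simp add: lam.br_add_left assms(2))

text \<open>
  An operation over \<open>\<lambda>\<close> has prescribed values on \<open>I L\<close>:
  \<open>{I x, u} = i(1) {1 \<otimes> x, u}\<close>, and multiplication by \<open>i(1)\<close> leaves only the contraction of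
  \<open>{1 \<otimes> x, u}\<close>, which can be computed in \<open>A \<otimes> L\<close>.
\<close>
lemma lifted_operation_iff:
  "lifted_operation A B i p L lam br \<longleftrightarrow>
     twisted_operation B L br \<and> (\<forall>u\<in>B.T. \<forall>v\<in>B.T. P (br u v) = lam (P u) (P v))"
proof
  assume "twisted_operation B L br \<and> (\<forall>u\<in>B.T. \<forall>v\<in>B.T. P (br u v) = lam (P u) (P v))"
  then have br: "twisted_operation B L br"
    and P: "\<And>u v. u \<in> B.T \<Longrightarrow> v \<in> B.T \<Longrightarrow> P (br u v) = lam (P u) (P v)" by auto
  interpret br: twisted_operation B L br by (rule br)
  have "br (I x) u = I (lbracket L x (B.ctr u))" if "u \<in> B.T" for x u
  proof -
    have "br (I x) u = I (B.ctr (br (B.unit_tensor x) u))"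
      unfolding I_eq_act[of x] using that by (simp add: br.br_act_left act_i[of "br _ _"])
    also have "B.ctr (br (B.unit_tensor x) u) = lbracket L x (B.ctr u)"
      using that by (simp add: ctr_P[symmetric] P ctr_lam)
    finally show ?thesis .
  qed
  then show "lifted_operation A B i p L lam br"
    using br.bilinear br.tw_br P by (simp add: lifted_operation_def Let_def aug_B)
next
  assume "lifted_operation A B i p L lam br"
  then show "twisted_operation B L br \<and> (\<forall>u\<in>B.T. \<forall>v\<in>B.T. P (br u v) = lam (P u) (P v))"
    using B.base_change_module_axioms
    by (auto simp: lifted_operation_def Let_def twisted_operation_def twisted_operation_axioms_def)
qed

end

section \<open>Cochains of low degree\<close>

definition cochain_of_bilinear :: "('l \<Rightarrow> 'l \<Rightarrow> 'l::zero) \<Rightarrow> 'l list \<Rightarrow> 'l" where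
  "cochain_of_bilinear g xs = (if length xs = 2 then g (xs ! 0) (xs ! 1) else 0)"

definition cochain_of_trilinear :: "('l \<Rightarrow> 'l \<Rightarrow> 'l \<Rightarrow> 'l::zero) \<Rightarrow> 'l list \<Rightarrow> 'l" where
  "cochain_of_trilinear g xs = (if length xs = 3 then g (xs ! 0) (xs ! 1) (xs ! 2) else 0)"

lemma cochain_of_bilinear_apply [simp]: "cochain_of_bilinear g [x, y] = g x y"
  by (simp add: cochain_of_bilinear_def)

lemma cochain_of_trilinear_apply [simp]: "cochain_of_trilinear g [x, y, z] = g x y z"
  by (simp add: cochain_of_trilinear_def)

context hom_leibniz_structure begin

lemma cochains_diff:
  assumes "\<phi> \<in> cochains L n" "\<psi> \<in> cochains L n"
  shows "\<phi> - \<psi> \<in> cochains L n"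
  using assms unfolding cochains_def Vector_Spaces.linear_iff
  by (simp add: fun_pointwise twist_diff W.scale_right_diff_distrib algebra_simps)

lemma zero_in_cochains: "0 \<in> cochains L n"
  using twist_diff[of 0 0] W.vector_space_axioms
  by (simp add: cochains_def Vector_Spaces.linear_iff fun_pointwise)

lemma coboundary_diff: "coboundary L n (\<phi> - \<psi>) = coboundary L n \<phi> - coboundary L n \<psi>"
  by (simp add: fun_eq_iff coboundary_def fun_pointwise bracket_diff W.scale_right_diff_distrib
      sum_subtractf sum.distrib sum_negf Let_def algebra_simps)

lemma coboundary_3_in_coboundaries: "\<psi> \<in> cochains L 2 \<Longrightarrow> coboundary L 2 \<psi> \<in> coboundaries L 3"
  by (simp add: coboundaries_def)

lemma coboundaries_3_diff:
  assumes "\<phi> \<in> coboundaries L 3" "\<psi> \<in> coboundaries L 3"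
  shows "\<phi> - \<psi> \<in> coboundaries L 3"
  using assms cochains_diff by (force simp: coboundaries_def coboundary_diff[symmetric])

lemma zero_in_coboundaries_3: "0 \<in> coboundaries L 3"
  using coboundary_3_in_coboundaries[OF zero_in_cochains] coboundary_diff[of 2 0 0] by simp

text \<open>The coboundaries form a subgroup, of which the cohomology classes are the cosets.\<close>
lemma cohomology_class_eq_iff:
  "cohomology_class L 3 \<phi> = cohomology_class L 3 \<psi> \<longleftrightarrow> \<phi> - \<psi> \<in> coboundaries L 3"
proof
  assume "cohomology_class L 3 \<phi> = cohomology_class L 3 \<psi>"
  moreover have "\<phi> + 0 \<in> cohomology_class L 3 \<phi>"
    unfolding cohomology_class_def by (rule set_plus_intro2) (rule zero_in_coboundaries_3)
  ultimately obtain b where "b \<in> coboundaries L 3" "\<phi> = \<psi> + b"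
    by (auto simp: cohomology_class_def elt_set_plus_def)
  then show "\<phi> - \<psi> \<in> coboundaries L 3" by (simp add: algebra_simps)
next
  assume diff: "\<phi> - \<psi> \<in> coboundaries L 3"
  have "\<exists>b'\<in>coboundaries L 3. \<phi> + b = \<psi> + b'" "\<exists>b'\<in>coboundaries L 3. \<psi> + b = \<phi> + b'"
    if b: "b \<in> coboundaries L 3" for b
  proof -
    have neg: "\<psi> - \<phi> \<in> coboundaries L 3"
      using coboundaries_3_diff[OF zero_in_coboundaries_3 diff] by simp
    have "b - (\<psi> - \<phi>) \<in> coboundaries L 3" "b - (\<phi> - \<psi>) \<in> coboundaries L 3"
      using b diff neg by (auto intro: coboundaries_3_diff)
    moreover have "\<phi> + b = \<psi> + (b - (\<psi> - \<phi>))" "\<psi> + b = \<phi> + (b - (\<phi> - \<psi>))"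
      by (simp_all add: algebra_simps)
    ultimately show "\<exists>b'\<in>coboundaries L 3. \<phi> + b = \<psi> + b'" "\<exists>b'\<in>coboundaries L 3. \<psi> + b = \<phi> + b'"
      by blast+
  qed
  then show "cohomology_class L 3 \<phi> = cohomology_class L 3 \<psi>"
    unfolding cohomology_class_def elt_set_plus_def by blast
qed

lemma coboundary_2:
  "coboundary L 2 \<psi> [x, y, z] = lbracket L (ltwist L x) (\<psi> [y, z])
     + lbracket L (\<psi> [x, z]) (ltwist L y) - lbracket L (\<psi> [x, y]) (ltwist L z)
     - \<psi> [lbracket L x y, ltwist L z] + \<psi> [lbracket L x z, ltwist L y] + \<psi> [ltwist L x, lbracket L y z]"
  by (simp add: coboundary_def omit_def Let_def numeral_eq_Suc atLeastAtMostSuc_conv insert_commute algebra_simps)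

lemma coboundary_3:
  "coboundary L 3 \<phi> [x1, x2, x3, x4] =
     lbracket L (ltwist L (ltwist L x1)) (\<phi> [x2, x3, x4])
     + lbracket L (\<phi> [x1, x3, x4]) (ltwist L (ltwist L x2))
     - lbracket L (\<phi> [x1, x2, x4]) (ltwist L (ltwist L x3))
     + lbracket L (\<phi> [x1, x2, x3]) (ltwist L (ltwist L x4))
     - \<phi> [lbracket L x1 x2, ltwist L x3, ltwist L x4]
     + \<phi> [lbracket L x1 x3, ltwist L x2, ltwist L x4]
     - \<phi> [lbracket L x1 x4, ltwist L x2, ltwist L x3]
     + \<phi> [ltwist L x1, lbracket L x2 x3, ltwist L x4]
     - \<phi> [ltwist L x1, lbracket L x2 x4, ltwist L x3]
     - \<phi> [ltwist L x1, ltwist L x2, lbracket L x3 x4]"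
  by (simp add: coboundary_def omit_def Let_def numeral_eq_Suc atLeastAtMostSuc_conv algebra_simps)

lemma cochain_2:
  assumes "\<psi> \<in> cochains L 2"
  shows "\<psi> [x + x', y] = \<psi> [x, y] + \<psi> [x', y]" "\<psi> [x, y + y'] = \<psi> [x, y] + \<psi> [x, y']"
    "\<psi> [lscale L c x, y] = lscale L c (\<psi> [x, y])" "\<psi> [x, lscale L c y] = lscale L c (\<psi> [x, y])"
    "ltwist L (\<psi> [x, y]) = \<psi> [ltwist L x, ltwist L y]"
proof -
  have lin: "Vector_Spaces.linear (lscale L) (lscale L) (\<lambda>z. \<psi> ([x, y][k := z]))" if "k < 2" for k x y
    using assms that by (simp add: cochains_def del: list_update.simps)
  show "\<psi> [x + x', y] = \<psi> [x, y] + \<psi> [x', y]" "\<psi> [x, y + y'] = \<psi> [x, y] + \<psi> [x, y']"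
    "\<psi> [lscale L c x, y] = lscale L c (\<psi> [x, y])" "\<psi> [x, lscale L c y] = lscale L c (\<psi> [x, y])"
    using lin[of 0] lin[of 1] by (simp_all add: Vector_Spaces.linear_iff)
  show "ltwist L (\<psi> [x, y]) = \<psi> [ltwist L x, ltwist L y]"
    using assms by (simp add: cochains_def)
qed

lemma cochain_3:
  assumes "\<phi> \<in> cochains L 3"
  shows "\<phi> [x + x', y, z] = \<phi> [x, y, z] + \<phi> [x', y, z]" "\<phi> [x, y + y', z] = \<phi> [x, y, z] + \<phi> [x, y', z]"
    "\<phi> [x, y, z + z'] = \<phi> [x, y, z] + \<phi> [x, y, z']"
    "\<phi> [lscale L c x, y, z] = lscale L c (\<phi> [x, y, z])" "\<phi> [x, lscale L c y, z] = lscale L c (\<phi> [x, y, z])"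
    "\<phi> [x, y, lscale L c z] = lscale L c (\<phi> [x, y, z])"
proof -
  have lin: "Vector_Spaces.linear (lscale L) (lscale L) (\<lambda>w. \<phi> ([x, y, z][k := w]))" if "k < 3" for k x y z
    using assms that by (simp add: cochains_def del: list_update.simps)
  show "\<phi> [x + x', y, z] = \<phi> [x, y, z] + \<phi> [x', y, z]" "\<phi> [x, y + y', z] = \<phi> [x, y, z] + \<phi> [x, y', z]"
    "\<phi> [x, y, z + z'] = \<phi> [x, y, z] + \<phi> [x, y, z']"
    "\<phi> [lscale L c x, y, z] = lscale L c (\<phi> [x, y, z])" "\<phi> [x, lscale L c y, z] = lscale L c (\<phi> [x, y, z])"
    "\<phi> [x, y, lscale L c z] = lscale L c (\<phi> [x, y, z])"
    using lin[of 0] lin[of 1] lin[of 2] by (simp_all add: Vector_Spaces.linear_iff numeral_2_eq_2)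
qed

lemma cochain_of_bilinear_in:
  assumes "\<And>x x' y. g (x + x') y = g x y + g x' y" "\<And>x y y'. g x (y + y') = g x y + g x y'"
    and "\<And>c x y. g (lscale L c x) y = lscale L c (g x y)" "\<And>c x y. g x (lscale L c y) = lscale L c (g x y)"
    and "\<And>x y. ltwist L (g x y) = g (ltwist L x) (ltwist L y)"
  shows "cochain_of_bilinear g \<in> cochains L 2"
  using assms W.vector_space_axioms
  by (auto simp: cochains_def cochain_of_bilinear_def Vector_Spaces.linear_iff less_2_cases_iff)

lemma cochain_of_trilinear_in:
  assumes "\<And>x x' y z. g (x + x') y z = g x y z + g x' y z" "\<And>x y y' z. g x (y + y') z = g x y z + g x y' z"
    "\<And>x y z z'. g x y (z + z') = g x y z + g x y z'"
    and "\<And>c x y z. g (lscale L c x) y z = lscale L c (g x y z)" "\<And>c x y z. g x (lscale L c y) z = lscale L c (g x y z)"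
    "\<And>c x y z. g x y (lscale L c z) = lscale L c (g x y z)"
    and "\<And>x y z. ltwist L (g x y z) = g (ltwist L x) (ltwist L y) (ltwist L z)"
  shows "cochain_of_trilinear g \<in> cochains L 3"
proof -
  have "k < 3 \<longleftrightarrow> k = 0 \<or> k = 1 \<or> k = 2" for k :: nat by auto
  then show ?thesis
    using assms W.vector_space_axioms
    by (auto simp: cochains_def cochain_of_trilinear_def Vector_Spaces.linear_iff)
qed

end

section \<open>The obstruction cocycle of a lift\<close>

locale lifted_bracket = deformation_extension A B L i p lam
  for A :: "('k::field, 'a::ab_group_add) aug_algebra"
    and B :: "('k, 'b::ab_group_add) aug_algebra"
    and L :: "('k, 'l::ab_group_add) hom_algebra"
    and i p lam +
  fixes br :: "('k, 'b, 'l) tensor \<Rightarrow> ('k, 'b, 'l) tensor \<Rightarrow> ('k, 'b, 'l) tensor"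
  assumes lifted: "lifted_operation A B i p L lam br"
begin

sublocale br: twisted_operation B L br
  using lifted lifted_operation_iff by blast

lemma P_br [simp]: "u \<in> B.T \<Longrightarrow> v \<in> B.T \<Longrightarrow> P (br u v) = lam (P u) (P v)"
  using lifted lifted_operation_iff by blast

lemma br_I_left: "u \<in> B.T \<Longrightarrow> br (I x) u = I (lbracket L x (B.ctr u))"
  using lifted by (simp add: lifted_operation_def Let_def aug_B)

lemma ctr_br [simp]: "u \<in> B.T \<Longrightarrow> v \<in> B.T \<Longrightarrow> B.ctr (br u v) = lbracket L (B.ctr u) (B.ctr v)"
  by (simp add: ctr_P[symmetric] ctr_lam)

lemma br_I_right:
  assumes "u \<in> B.T" shows "br u (I x) = I (lbracket L (B.ctr u) x)"
proof -
  have "br u (I x) = B.act (i 1) (br u (B.unit_tensor x))"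
    unfolding I_eq_act using assms by (simp add: br.br_act_right)
  also have "\<dots> = I (lbracket L (B.ctr u) x)"
    using assms by (simp add: act_i)
  finally show ?thesis .
qed

lemma P_defect:
  assumes "u \<in> B.T" "v \<in> B.T" "w \<in> B.T"
  shows "P (br.defect u v w) = 0"
  using lam_defect[of "P u" "P v" "P w"] assms by (simp add: leibniz_defect_def)

lemma obstruction_cochain_iff:
  "obstruction_cochain B i L br \<phi> \<longleftrightarrow> \<phi> \<in> cochains L 3 \<and>
     (\<forall>x y z. I (\<phi> [x, y, z]) = br.defect (B.unit_tensor x) (B.unit_tensor y) (B.unit_tensor z))"
  by (simp add: obstruction_cochain_def leibniz_defect_def B.tw_pure Let_def)

text \<open>
  Since the defect of a lift lies over that of \<open>\<lambda>\<close>, which is 0, its values on the generators are in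
  the kernel of \<open>P\<close>. Injectivity of \<open>I\<close> carries trilinearity and compatibility with the
  twist over to the cochain.
\<close>
lemma obstruction_cochain_exists: "\<exists>\<phi>. obstruction_cochain B i L br \<phi>"
proof -
  let ?e = "B.unit_tensor"
  have "\<exists>l. I l = br.defect (?e x) (?e y) (?e z)" for x y z
    using kernel_P[of "br.defect (?e x) (?e y) (?e z)"] P_defect by (metis B.pure_tensor_in_tensor_space br.defect_in)
  then obtain g where g: "I (g x y z) = br.defect (?e x) (?e y) (?e z)" for x y z by metis
  note I = I_inj[THEN iffD1]
  have "cochain_of_trilinear g \<in> cochains L 3"
  proof (rule A.cochain_of_trilinear_in)
    show "g (x + x') y z = g x y z + g x' y z" "g x (y + y') z = g x y z + g x y' z"
      "g x y (z + z') = g x y z + g x y z'" for x x' y y' z z'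
      by (rule I, simp add: g I_add B.pure_tensor_add_right br.defect_add)+
    show "g (lscale L c x) y z = lscale L c (g x y z)" "g x (lscale L c y) z = lscale L c (g x y z)"
      "g x y (lscale L c z) = lscale L c (g x y z)" for c x y z
      by (rule I, simp add: g B.unit_tensor_scale br.defect_act,
          simp add: g[symmetric] act_I)+
    show "ltwist L (g x y z) = g (ltwist L x) (ltwist L y) (ltwist L z)" for x y z
      by (rule I, simp add: g B.tw_pure[symmetric] br.tw_defect[symmetric])
  qed
  then show ?thesis
    by (intro exI[of _ "cochain_of_trilinear g"]) (simp add: obstruction_cochain_iff g)
qed

text \<open>
  The obstruction cochain is defined by the defect on generators only. The general formula is needed
  because brackets of generators are no longer generators.
\<close>
lemma defect_eq:
  assumes \<phi>: "obstruction_cochain B i L br \<phi>" and T: "u \<in> B.T" "v \<in> B.T" "w \<in> B.T"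
  shows "br.defect u v w = I (\<phi> [B.ctr u, B.ctr v, B.ctr w])"
proof -
  note c = A.cochain_3[of \<phi>]
  have \<phi>': "\<phi> \<in> cochains L 3"
    and unit: "br.defect (B.unit_tensor x) (B.unit_tensor y) (B.unit_tensor z) = I (\<phi> [x, y, z])" for x y z
    using \<phi> by (simp_all add: obstruction_cochain_iff)
  have 1: "br.defect u (B.unit_tensor y) (B.unit_tensor z) = I (\<phi> [B.ctr u, y, z])" if "u \<in> B.T" for u y z
    by (rule base_linear_factors[where g = "\<lambda>x. \<phi> [x, y, z]"])
      (simp_all add: unit c \<phi>' that br.defect_add br.defect_act)
  have 2: "br.defect u v (B.unit_tensor z) = I (\<phi> [B.ctr u, B.ctr v, z])" if "u \<in> B.T" "v \<in> B.T" for u v z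
    by (rule base_linear_factors[where g = "\<lambda>x. \<phi> [B.ctr u, x, z]"])
      (simp_all add: 1 c \<phi>' that br.defect_add br.defect_act)
  show ?thesis
    by (rule base_linear_factors[where g = "\<lambda>x. \<phi> [B.ctr u, B.ctr v, x]"])
      (simp_all add: 2 c \<phi>' T br.defect_add br.defect_act)
qed

text \<open>
  On generators, every term of the identity for the defect lies in \<open>I L\<close>, and contracting the
  arguments turns the brackets of the lift into brackets of \<open>L\<close>: the identity becomes \<open>I\<close> applied to
  the coboundary of \<open>\<phi>\<close>.
\<close>
lemma obstruction_cocycle:
  assumes \<phi>: "obstruction_cochain B i L br \<phi>"
  shows "\<phi> \<in> cocycles L 3"
proof -
  let ?e = "B.unit_tensor"
  have zero: "coboundary L 3 \<phi> [x1, x2, x3, x4] = 0" for x1 x2 x3 x4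
  proof -
    have "I (coboundary L 3 \<phi> [x1, x2, x3, x4]) = I 0"
      using br.defect_cocycle_identity[of "?e x1" "?e x2" "?e x3" "?e x4"]
      by (simp add: defect_eq[OF \<phi>] br_I_left br_I_right A.coboundary_3 I_add I_diff)
    then show ?thesis by (simp only: I_inj)
  qed
  have "coboundary L 3 \<phi> xs = 0" for xs
  proof (cases "length xs = 4")
    case True
    then obtain x1 x2 x3 x4 where "xs = [x1, x2, x3, x4]"
      by (auto simp: numeral_eq_Suc length_Suc_conv)
    then show ?thesis by (simp add: zero)
  qed (simp add: coboundary_def)
  then show ?thesis
    using \<phi> by (auto simp: cocycles_def obstruction_cochain_iff fun_eq_iff fun_pointwise)
qed

end

context deformation_extension begin

text \<open>
  The difference of two lifts is \<open>B\<close>-bilinear and killed by \<open>P\<close>, so it factors through the contraction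
  in both arguments.
\<close>
lemma lifts_differ_by_cochain:
  assumes "lifted_operation A B i p L lam br" "lifted_operation A B i p L lam br'"
  obtains \<psi> where "\<psi> \<in> cochains L 2"
    "\<And>u v. u \<in> B.T \<Longrightarrow> v \<in> B.T \<Longrightarrow> br u v = br' u v + I (\<psi> [B.ctr u, B.ctr v])"
proof -
  interpret l: lifted_bracket A B L i p lam br by unfold_locales fact
  interpret l': lifted_bracket A B L i p lam br' by unfold_locales fact
  let ?e = "B.unit_tensor"
  define D where "D u v = br u v - br' u v" for u v
  have add: "D (u + v) w = D u w + D v w" "D u (v + w) = D u v + D u w"
    if "u \<in> B.T" "v \<in> B.T" "w \<in> B.T" for u v w
    using that by (simp_all add: D_def l.br.br_add_left l'.br.br_add_left l.br.br_add_right l'.br.br_add_right)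
  have act: "D (B.act b u) v = B.act b (D u v)" "D u (B.act b v) = B.act b (D u v)"
    if "u \<in> B.T" "v \<in> B.T" for b u v
    using that
    by (simp_all add: D_def l.br.br_act_left l'.br.br_act_left l.br.br_act_right l'.br.br_act_right B.act_diff)
  have tw: "B.tw (D u v) = D (B.tw u) (B.tw v)" if "u \<in> B.T" "v \<in> B.T" for u v
    using that by (simp add: D_def l.br.tw_br l'.br.tw_br B.tw_diff)
  have "\<exists>z. I z = D (?e x) (?e y)" for x y
  proof (rule kernel_P)
    show "D (?e x) (?e y) \<in> B.T" "P (D (?e x) (?e y)) = 0"
      by (simp_all add: D_def l.P_br l'.P_br)
  qed (rule exI, rule sym)
  then obtain g where g: "I (g x y) = D (?e x) (?e y)" for x y by metis
  note I = I_inj[THEN iffD1]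
  have g_add: "g (x + x') y = g x y + g x' y" "g x (y + y') = g x y + g x y'" for x x' y y'
    by (rule I, simp add: g I_add B.pure_tensor_add_right add)+
  have g_scale: "g (lscale L c x) y = lscale L c (g x y)" "g x (lscale L c y) = lscale L c (g x y)" for c x y
    by (rule I, simp add: g B.unit_tensor_scale act, simp add: g[symmetric] act_I)+
  have g_tw: "ltwist L (g x y) = g (ltwist L x) (ltwist L y)" for x y
    by (rule I) (simp add: g B.tw_pure[symmetric] tw[symmetric])
  have 1: "D u (?e y) = I (g (B.ctr u) y)" if "u \<in> B.T" for u y
    by (rule base_linear_factors[where g = "\<lambda>x. g x y"]) (simp_all add: g g_add g_scale that add act)
  have "D u v = I (g (B.ctr u) (B.ctr v))" if "u \<in> B.T" "v \<in> B.T" for u v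
    by (rule base_linear_factors[where g = "\<lambda>x. g (B.ctr u) x"])
      (simp_all add: 1 g_add g_scale that add act)
  then have "br u v = br' u v + I (cochain_of_bilinear g [B.ctr u, B.ctr v])"
    if "u \<in> B.T" "v \<in> B.T" for u v
    using that by (simp add: D_def algebra_simps)
  moreover have "cochain_of_bilinear g \<in> cochains L 2"
    by (rule A.cochain_of_bilinear_in) (simp_all add: g_add g_scale g_tw)
  ultimately show thesis using that by blast
qed

text \<open>
  In \<open>{\<alpha> u, {v, w}}\<close> the change of the inner bracket contributes \<open>I [\<alpha> E u, \<psi>(E v, E w)]\<close> and
  that of the outer one \<open>I \<psi>(\<alpha> E u, [E v, E w])\<close>; similarly for the other two terms. Nothing quadratic
  in \<open>\<psi>\<close> appears, since \<open>E\<close> vanishes on \<open>I L\<close>. The contributions are exactly the terms of the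
  coboundary.
\<close>
lemma defect_shift:
  assumes "lifted_operation A B i p L lam br" "lifted_operation A B i p L lam br'"
    and \<psi>: "\<psi> \<in> cochains L 2"
    and eq: "\<And>u v. u \<in> B.T \<Longrightarrow> v \<in> B.T \<Longrightarrow> br u v = br' u v + I (\<psi> [B.ctr u, B.ctr v])"
    and T: "u \<in> B.T" "v \<in> B.T" "w \<in> B.T"
  shows "leibniz_defect B.tw br u v w =
    leibniz_defect B.tw br' u v w + I (coboundary L 2 \<psi> [B.ctr u, B.ctr v, B.ctr w])"
proof -
  interpret l': lifted_bracket A B L i p lam br' by unfold_locales fact
  show ?thesis
    using T
    by (simp add: leibniz_defect_def eq l'.br.br_add_left l'.br.br_add_right l'.br_I_left l'.br_I_right
        l'.ctr_br A.coboundary_2 I_add I_diff)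
qed

lemma obstruction_cochains_cohomologous:
  assumes l: "lifted_operation A B i p L lam br" and \<phi>: "obstruction_cochain B i L br \<phi>"
    and l': "lifted_operation A B i p L lam br'" and \<phi>': "obstruction_cochain B i L br' \<phi>'"
  shows "cohomology_class L 3 \<phi> = cohomology_class L 3 \<phi>'"
proof -
  interpret l: lifted_bracket A B L i p lam br by unfold_locales fact
  interpret l': lifted_bracket A B L i p lam br' by unfold_locales fact
  obtain \<psi> where \<psi>: "\<psi> \<in> cochains L 2"
    and eq: "\<And>u v. u \<in> B.T \<Longrightarrow> v \<in> B.T \<Longrightarrow> br u v = br' u v + I (\<psi> [B.ctr u, B.ctr v])"
    using lifts_differ_by_cochain[OF l l'] by blast
  have "\<phi> [x, y, z] = \<phi>' [x, y, z] + coboundary L 2 \<psi> [x, y, z]" for x y z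
  proof -
    have "I (\<phi> [x, y, z]) = leibniz_defect B.tw br (B.unit_tensor x) (B.unit_tensor y) (B.unit_tensor z)"
      using \<phi> by (simp add: l.obstruction_cochain_iff)
    also have "\<dots> = leibniz_defect B.tw br' (B.unit_tensor x) (B.unit_tensor y) (B.unit_tensor z)
        + I (coboundary L 2 \<psi> [x, y, z])"
      by (subst defect_shift[OF l l' \<psi> eq]) simp_all
    also have "\<dots> = I (\<phi>' [x, y, z] + coboundary L 2 \<psi> [x, y, z])"
      using \<phi>' by (simp add: l'.obstruction_cochain_iff I_add)
    finally have "I (\<phi> [x, y, z]) = I (\<phi>' [x, y, z] + coboundary L 2 \<psi> [x, y, z])" .
    then show ?thesis by (simp only: I_inj)
  qed
  moreover have "\<phi> xs = 0" "\<phi>' xs = 0" "coboundary L 2 \<psi> xs = 0" if "length xs \<noteq> 3" for xs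
    using \<phi> \<phi>' that by (simp_all add: l.obstruction_cochain_iff l'.obstruction_cochain_iff cochains_def coboundary_def)
  ultimately have "(\<phi> - \<phi>') xs = coboundary L 2 \<psi> xs" for xs
    by (cases "length xs = 3") (auto simp: fun_pointwise numeral_eq_Suc length_Suc_conv)
  then have "\<phi> - \<phi>' = coboundary L 2 \<psi>" by (rule ext)
  then show ?thesis
    by (simp add: A.cohomology_class_eq_iff A.coboundary_3_in_coboundaries \<psi>)
qed

lemma shifted_lift:
  assumes l: "lifted_operation A B i p L lam br" and \<psi>: "\<psi> \<in> cochains L 2"
  shows "lifted_operation A B i p L lam (\<lambda>u v. br u v - I (\<psi> [B.ctr u, B.ctr v]))"
proof -
  interpret l: lifted_bracket A B L i p lam br by unfold_locales fact
  note \<psi>' = A.cochain_2[OF \<psi>]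
  have "twisted_operation B L (\<lambda>u v. br u v - I (\<psi> [B.ctr u, B.ctr v]))"
  proof
    show "bilinear_operation B.act B.T (\<lambda>u v. br u v - I (\<psi> [B.ctr u, B.ctr v]))"
      by (simp add: bilinear_operation_def l.br.br_add_left l.br.br_add_right l.br.br_act_left
          l.br.br_act_right \<psi>' I_add B.act_diff act_I)
    show "B.tw (br u v - I (\<psi> [B.ctr u, B.ctr v])) = br (B.tw u) (B.tw v) - I (\<psi> [B.ctr (B.tw u), B.ctr (B.tw v)])"
      if "u \<in> B.T" "v \<in> B.T" for u v
      using that by (simp add: l.br.tw_br B.tw_diff B.tw_pure \<psi>')
  qed
  then show ?thesis by (simp add: lifted_operation_iff l.P_br)
qed

text \<open>Being a lift can be tested on generators, which is how a push-out is described.\<close>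
lemma lift_of_units:
  assumes br: "twisted_operation B L br"
    and unit: "\<And>x y. P (br (B.unit_tensor x) (B.unit_tensor y)) = lam (A.unit_tensor x) (A.unit_tensor y)"
  shows "lifted_operation A B i p L lam br"
proof -
  interpret br: twisted_operation B L br by (rule br)
  have 1: "P (br u (B.unit_tensor y)) = lam (P u) (A.unit_tensor y)" if "u \<in> B.T" for u y
    using that
    by (induction rule: B.base_change_induct)
      (simp_all add: br.br_act_left lam.br_act_left unit br.br_add_left lam.br_add_left del: id_apply)
  have "P (br u v) = lam (P u) (P v)" if "u \<in> B.T" "v \<in> B.T" for u v
    using that(2,1)
    by (induction rule: B.base_change_induct)
      (simp_all add: br.br_act_right lam.br_act_right 1 br.br_add_right lam.br_add_right del: id_apply)
  then show ?thesis by (simp add: lifted_operation_iff br)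
qed

text \<open>
  The push-out condition says that \<open>mu\<close> lies over \<open>\<lambda>\<close> on generators. Conversely, a lift inherits
  the augmentation condition from \<open>\<lambda>\<close>, because the augmentation of \<open>B\<close> factors through \<open>p\<close>.
\<close>
lemma deformation_iff_lift:
  "deformation B L mu \<and> is_push_out B A L p mu lam \<longleftrightarrow>
     lifted_operation A B i p L lam mu \<and>
     (\<forall>u\<in>B.T. \<forall>v\<in>B.T. \<forall>w\<in>B.T. leibniz_defect B.tw mu u v w = 0)"
proof
  assume mu: "deformation B L mu \<and> is_push_out B A L p mu lam"
  have tw_mu: "twisted_operation B L mu"
    using mu B.base_change_module_axioms
    by (simp add: deformation_def hom_leibniz_def twisted_operation_def twisted_operation_axioms_def)
  have unit: "P (mu (B.unit_tensor x) (B.unit_tensor y)) = lam (A.unit_tensor x) (A.unit_tensor y)" for x y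
    using mu by (simp add: is_push_out_def)
  have "lifted_operation A B i p L lam mu" by (rule lift_of_units) (fact tw_mu, fact unit)
  moreover have "leibniz_defect B.tw mu u v w = 0" if "u \<in> B.T" "v \<in> B.T" "w \<in> B.T" for u v w
    using mu that by (simp add: deformation_def hom_leibniz_def leibniz_defect_def)
  ultimately show "lifted_operation A B i p L lam mu \<and>
     (\<forall>u\<in>B.T. \<forall>v\<in>B.T. \<forall>w\<in>B.T. leibniz_defect B.tw mu u v w = 0)"
    by blast
next
  assume mu: "lifted_operation A B i p L lam mu \<and>
     (\<forall>u\<in>B.T. \<forall>v\<in>B.T. \<forall>w\<in>B.T. leibniz_defect B.tw mu u v w = 0)"
  interpret l: lifted_bracket A B L i p lam mu by unfold_locales (use mu in blast)
  have "mu (B.tw u) (mu v w) = mu (mu u v) (B.tw w) - mu (mu u w) (B.tw v)"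
    if "u \<in> B.T" "v \<in> B.T" "w \<in> B.T" for u v w
  proof -
    have "leibniz_defect B.tw mu u v w = 0" using mu that by blast
    then show ?thesis by (simp add: leibniz_defect_def algebra_simps)
  qed
  then have "deformation B L mu"
    by (simp add: deformation_def hom_leibniz_def l.br.bilinear l.br.tw_br B.tw_add B.tw_act l.ctr_br)
  then show "deformation B L mu \<and> is_push_out B A L p mu lam"
    by (simp add: is_push_out_def deformation l.P_br)
qed

end

section \<open>Existence of lifts\<close>

lemma finite_dimensional_space_of_span:
  assumes "vector_space s" "finite S" "module.span s S = UNIV"
  shows "\<exists>Bas. finite_dimensional_vector_space s Bas"
proof -
  interpret vector_space s by fact
  obtain Bas where "Bas \<subseteq> S" "independent Bas" "S \<subseteq> span Bas"
    by (rule maximal_independent_subset)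
  moreover from this have "span Bas = UNIV"
    using span_mono[of S "span Bas"] assms(3) by (auto simp: span_span)
  ultimately have "finite_dimensional_vector_space s Bas"
    using assms(2) by unfold_locales (auto intro: finite_subset)
  then show ?thesis ..
qed

context extension_base_change begin

text \<open>A basis of \<open>A\<close>, moved to \<open>B\<close> by a section of \<open>p\<close>, spans \<open>B\<close> together with \<open>i(1)\<close>.\<close>
lemma finite_dimensional_extension:
  assumes "finite_dimensional_algebra A"
  shows "finite_dimensional_algebra B"
proof -
  obtain Bas where Bas: "finite_dimensional_vector_space (ascale A) Bas"
    using assms by (auto simp: finite_dimensional_algebra_def)
  interpret FA: finite_dimensional_vector_space "ascale A" Bas by fact
  obtain \<sigma> \<kappa> where \<sigma>: "Vector_Spaces.linear (ascale A) (ascale B) \<sigma>"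
    and split: "\<And>b. b = \<sigma> (p b) + i (\<kappa> b)" by (rule splitting) (rule that)
  interpret \<sigma>: Vector_Spaces.linear "ascale A" "ascale B" \<sigma> by fact
  let ?S = "insert (i 1) (\<sigma> ` Bas)"
  have "b \<in> B.V.span ?S" for b
  proof -
    have "\<sigma> (p b) \<in> B.V.span (\<sigma> ` Bas)"
      using FA.span_Basis by (simp add: \<sigma>.span_image)
    then have "\<sigma> (p b) \<in> B.V.span ?S"
      using B.V.span_mono[of "\<sigma> ` Bas" ?S] by blast
    moreover have "i (\<kappa> b) \<in> B.V.span ?S"
      by (subst i_scale) (intro B.V.span_scale B.V.span_base insertI1)
    ultimately show ?thesis
      by (subst split) (rule B.V.span_add)
  qed
  then have "B.V.span ?S = UNIV" by blast
  then show ?thesis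
    using finite_dimensional_space_of_span[OF B.V.vector_space_axioms, of ?S] FA.finite_Basis
    by (simp add: finite_dimensional_algebra_def)
qed

end

context deformation_extension begin

text \<open>
  A linear section \<open>\<sigma>\<close> of \<open>p\<close> is not multiplicative, so applying \<open>\<sigma> \<otimes> id\<close> to all brackets of
  \<open>\<lambda>\<close> would not give a \<open>B\<close>-bilinear operation. It is therefore applied only to the brackets of
  the generators. The twist acts on the other tensor factor and is respected.
\<close>
lemma lift_exists:
  assumes fin: "finite_dimensional_algebra A"
  shows "\<exists>br. lifted_operation A B i p L lam br"
proof -
  obtain \<sigma> \<kappa> where \<sigma>: "Vector_Spaces.linear (ascale A) (ascale B) \<sigma>" and p\<sigma>: "p \<circ> \<sigma> = id"
    by (rule splitting) (rule that)
  define S where "S = (tensor_map (ascale B) \<sigma> id :: ('k, 'a, 'l) tensor \<Rightarrow> _)"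
  have S_in: "S v \<in> B.T" if "v \<in> A.T" for v
    unfolding S_def using that by (rule tensor_map_in_tensor_space[OF \<sigma> A.linear_ids(2)])
  have S_add: "S (u + v) = S u + S v" for u v
    by (simp add: S_def tensor_map_add)
  have S_scale: "S (pt_scale (lscale L) c u) = pt_scale (lscale L) c (S u)" for c u
    by (auto simp: S_def tensor_map_def pt_scale_def fun_eq_iff)
  have S_tw: "S (A.tw u) = B.tw (S u)" for u
    unfolding S_def by (rule push_tw[OF B.base_change_module_axioms A.base_change_module_axioms \<sigma>])
  have P_S: "P (S v) = v" if "v \<in> A.T" for v
    using that A.tensor_space_eval_outside[OF that]
    by (simp add: S_def tensor_map_compose[OF linear_p] p\<sigma>) (auto simp: tensor_map_def fun_eq_iff)
  define m where "m x y = S (lam (A.unit_tensor x) (A.unit_tensor y))" for x y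
  have "\<exists>br. bilinear_operation B.act B.T br \<and> (\<forall>x y. br (B.unit_tensor x) (B.unit_tensor y) = m x y) \<and>
    (\<forall>u\<in>B.T. \<forall>v\<in>B.T. B.tw (br u v) = br (B.tw u) (B.tw v))"
  proof (rule B.bilinear_extension)
    show "finite_dimensional_algebra B" by (rule finite_dimensional_extension[OF fin])
    show "m x y \<in> B.T" for x y by (simp add: m_def S_in)
    show "m (x + x') y = m x y + m x' y" "m x (y + y') = m x y + m x y'" for x x' y y'
      by (simp_all add: m_def A.pure_tensor_add_right lam.br_add_left lam.br_add_right S_add)
    show "m (lscale L c x) y = pt_scale (lscale L) c (m x y)" "m x (lscale L c y) = pt_scale (lscale L) c (m x y)"
      for c x y
      unfolding m_def A.unit_tensor_scale
      by (simp_all add: lam.br_act_left lam.br_act_right A.scale_eq_act[of "lam _ _"] S_scale)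
    show "B.tw (m x y) = m (ltwist L x) (ltwist L y)" for x y
      by (simp add: m_def S_tw[symmetric] lam.tw_br A.tw_pure)
  qed
  then obtain br where bil: "bilinear_operation B.act B.T br"
    and unit: "\<And>x y. br (B.unit_tensor x) (B.unit_tensor y) = m x y"
    and tw: "\<And>u v. u \<in> B.T \<Longrightarrow> v \<in> B.T \<Longrightarrow> B.tw (br u v) = br (B.tw u) (B.tw v)" by blast
  have "twisted_operation B L br" by unfold_locales (fact bil, fact tw)
  then have "lifted_operation A B i p L lam br"
    by (rule lift_of_units) (simp add: unit m_def P_S)
  then show ?thesis by blast
qed

end

section \<open>Isomorphic extensions\<close>

lemma extension_isoE:
  assumes "extension_iso B i p B' i' p'"
  obtains h g where "algebra_hom B B' h" "algebra_hom B' B g" "h \<circ> g = id" "g \<circ> h = id"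
    "h \<circ> i = i'" "g \<circ> i' = i" "p' \<circ> h = p" "p \<circ> g = p'"
proof -
  obtain h where h: "algebra_hom B B' h" and bij: "bij h" and hi: "h \<circ> i = i'" and ph: "p' \<circ> h = p"
    using assms by (auto simp: extension_iso_def)
  have hg: "h (inv h y) = y" "inv h (h x) = x" for x y
    using bij by (simp_all add: bij_is_inj bij_is_surj surj_f_inv_f)
  have eqI: "x = y" if "h x = h y" for x y
    using that bij by (simp add: bij_is_inj inj_eq)
  have "algebra_hom B' B (inv h)"
    using h unfolding algebra_hom_def Vector_Spaces.linear_iff
    by (auto intro!: eqI simp: hg)
  then show thesis
    by (rule that[OF h]) (auto simp: hi[symmetric] ph[symmetric] hg)
qed

lemma extension_iso_sym:
  assumes "extension_iso B i p B' i' p'"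
  shows "extension_iso B' i' p' B i p"
  using assms by (rule extension_isoE) (auto simp: extension_iso_def intro: o_bij)

lemma extension_iso_trans:
  assumes "extension_iso B i p B' i' p'" "extension_iso B' i' p' B'' i'' p''"
  shows "extension_iso B i p B'' i'' p''"
proof -
  obtain h where h: "algebra_hom B B' h" "bij h" "h \<circ> i = i'" "p' \<circ> h = p"
    using assms by (auto simp: extension_iso_def)
  obtain g where g: "algebra_hom B' B'' g" "bij g" "g \<circ> i' = i''" "p'' \<circ> g = p'"
    using assms by (auto simp: extension_iso_def)
  have "algebra_hom B B'' (g \<circ> h)"
    using h(1) g(1) by (auto simp: algebra_hom_def Vector_Spaces.linear_iff)
  moreover have "bij (g \<circ> h)" using h(2) g(2) by (rule bij_comp)
  moreover have "(g \<circ> h) \<circ> i = i''" "p'' \<circ> (g \<circ> h) = p"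
    using h(3,4) g(3,4) by (auto simp: fun_eq_iff)
  ultimately show ?thesis unfolding extension_iso_def by blast
qed

text \<open>
  Adding the coboundary of \<open>g\<close> to \<open>f\<close> is undone by the shear \<open>(a, k) \<mapsto> (a, k - g a)\<close>.
\<close>
lemma cohomologous_cocycle_extensions_iso:
  fixes A :: "('k::field, 'a::ab_group_add) aug_algebra"
  assumes A: "augmented_algebra A"
    and V: "vector_space (ascale (cocycle_extension A f))" "vector_space (ascale (cocycle_extension A f'))"
    and g: "Vector_Spaces.linear (ascale A) (*) g"
    and f': "f' = (\<lambda>a b. f a b + (aug A a * g b - g (amult A a b) + g a * aug A b))"
  shows "extension_iso (cocycle_extension A f) (\<lambda>k. (0, k)) fst (cocycle_extension A f') (\<lambda>k. (0, k)) fst"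
proof -
  have g_add: "g (a + b) = g a + g b" and g_scale: "g (ascale A s a) = s * g a" for a b s
    using g by (simp_all add: Vector_Spaces.linear_iff)
  have "g 0 + 0 = g 0 + g 0"
    using g_add[of 0 0] by (simp only: add_0_left add_0_right)
  then have g_zero: "g 0 = 0"
    by (metis add_left_imp_eq)
  have mult_one: "amult A (aone A) (aone A) = aone A"
  proof -
    interpret R: comm_ring_1 "amult A" "aone A" "(+)" 0 "(-)" uminus
      using A by (simp add: augmented_algebra_def)
    show ?thesis by simp
  qed
  let ?h = "\<lambda>(a, k). (a, k - g a)"
  have "algebra_hom (cocycle_extension A f) (cocycle_extension A f') ?h"
    unfolding algebra_hom_def Vector_Spaces.linear_iff
  proof (intro conjI allI V)
    have one: "aug A (aone A) = 1"
      using A by (simp add: augmented_algebra_def)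
    show "?h (x + y) = ?h x + ?h y" for x y
      by (simp add: g_add split: prod.splits)
    show "?h (ascale (cocycle_extension A f) c x) = ascale (cocycle_extension A f') c (?h x)" for c x
      by (simp add: cocycle_extension_def g_scale right_diff_distrib split: prod.splits)
    show "?h (amult (cocycle_extension A f) x y) = amult (cocycle_extension A f') (?h x) (?h y)" for x y
      by (simp add: cocycle_extension_def f' algebra_simps split: prod.splits)
    show "?h (aone (cocycle_extension A f)) = aone (cocycle_extension A f')"
      by (simp add: cocycle_extension_def f' one mult_one)
  qed
  moreover have "bij ?h"
    by (rule bij_betw_byWitness[where f' = "\<lambda>(a, k). (a, k + g a)"]) auto
  ultimately show ?thesis
    unfolding extension_iso_def by (intro exI[of _ ?h]) (auto simp: fun_eq_iff g_zero)
qed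

lemma extensions_of_class_iso:
  fixes A :: "('k::field, 'a::ab_group_add) aug_algebra"
  assumes A: "augmented_algebra A"
    and B: "extension_of_class A B i p c" and B': "extension_of_class A B' i' p' c"
  shows "extension_iso B i p B' i' p'"
proof -
  obtain f where f: "f \<in> c" "extension_iso (cocycle_extension A f) (\<lambda>k. (0, k)) fst B i p"
    using B by (auto simp: extension_of_class_def)
  obtain f' where f': "f' \<in> c" "extension_iso (cocycle_extension A f') (\<lambda>k. (0, k)) fst B' i' p'"
    using B' by (auto simp: extension_of_class_def)
  have V: "vector_space (ascale (cocycle_extension A f))" "vector_space (ascale (cocycle_extension A f'))"
    using f(2) f'(2) by (auto simp: extension_iso_def algebra_hom_def Vector_Spaces.linear_iff)
  obtain f0 where "c = f0 +o harrison_coboundaries A"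
    using B by (auto simp: extension_of_class_def harrison_cohomology_def harrison_class_def)
  then obtain g1 g2 where g: "Vector_Spaces.linear (ascale A) (*) g1" "Vector_Spaces.linear (ascale A) (*) g2"
    and eq: "f = f0 + (\<lambda>a b. aug A a * g1 b - g1 (amult A a b) + g1 a * aug A b)"
      "f' = f0 + (\<lambda>a b. aug A a * g2 b - g2 (amult A a b) + g2 a * aug A b)"
    using f(1) f'(1) by (auto simp: elt_set_plus_def harrison_coboundaries_def)
  let ?g = "\<lambda>a. g2 a - g1 a"
  have "Vector_Spaces.linear (ascale A) (*) ?g"
    using g by (auto simp: Vector_Spaces.linear_iff algebra_simps)
  moreover have "f' = (\<lambda>a b. f a b + (aug A a * ?g b - ?g (amult A a b) + ?g a * aug A b))"
    by (simp add: eq fun_eq_iff fun_pointwise algebra_simps)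
  ultimately have "extension_iso (cocycle_extension A f) (\<lambda>k. (0, k)) fst
      (cocycle_extension A f') (\<lambda>k. (0, k)) fst"
    by (rule cohomologous_cocycle_extensions_iso[OF A V])
  then show ?thesis
    using f(2) f'(2) extension_iso_sym extension_iso_trans by metis
qed

text \<open>
  The obstruction is defined by means of extensions on the type of pairs; this lemma provides one. All
  ring laws are pulled back from \<open>B\<close> along the isomorphism that exhibits its class.
\<close>
lemma cocycle_extension_of_class:
  fixes A :: "('k::field, 'a::ab_group_add) aug_algebra"
  assumes A: "augmented_algebra A" and B: "extension_of_class A B i p c"
  shows "\<exists>f. extension_of_class A (cocycle_extension A f) (\<lambda>k. (0, k)) fst c"
proof -
  obtain f where f: "f \<in> c" and iso: "extension_iso (cocycle_extension A f) (\<lambda>k. (0, k)) fst B i p"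
    using B by (auto simp: extension_of_class_def)
  let ?C = "cocycle_extension A f"
  obtain h where h: "algebra_hom ?C B h" and bij: "bij h" and hi: "h \<circ> (\<lambda>k. (0, k)) = i" and ph: "p \<circ> h = fst"
    using iso by (auto simp: extension_iso_def)
  have ext: "extension A B i p" using B by (simp add: extension_of_class_def)
  interpret B: comm_ring_1 "amult B" "aone B" "(+)" 0 "(-)" uminus
    using ext by (simp add: extension_def augmented_algebra_def)
  have V: "vector_space (ascale ?C)" and VB: "vector_space (ascale B)" and h_add: "h (x + y) = h x + h y"
    and h_scale: "h (ascale ?C s x) = ascale B s (h x)"
    and h_mult: "h (amult ?C x y) = amult B (h x) (h y)" and h_one: "h (aone ?C) = aone B" for s x y
    using h unfolding algebra_hom_def Vector_Spaces.linear_iff by blast+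
  have h_zero: "h 0 = 0" using h_add[of 0 0] by simp
  have eqI: "x = y" if "h x = h y" for x y
    using that bij by (simp add: bij_is_inj inj_eq)
  have hi': "h (0, k) = i k" for k using hi by (auto simp: fun_eq_iff)
  have aug_C: "aug ?C = aug A \<circ> fst" by (auto simp: cocycle_extension_def)
  have ph': "fst x = p (h x)" for x using fun_cong[OF ph, of x] by simp
  have ring: "class.comm_ring_1 (amult ?C) (aone ?C) (+) 0 (-) uminus"
  proof
    show "amult ?C (amult ?C x y) z = amult ?C x (amult ?C y z)" for x y z
      by (rule eqI) (simp add: h_mult B.mult.assoc)
    show "amult ?C x y = amult ?C y x" for x y
      by (rule eqI) (simp add: h_mult B.mult.commute)
    show "amult ?C (aone ?C) x = x" for x
      by (rule eqI) (simp add: h_mult h_one)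
    show "amult ?C (x + y) z = amult ?C x z + amult ?C y z" for x y z
      by (rule eqI) (simp add: h_mult h_add B.distrib_right)
    show "(0 :: 'a \<times> 'k) \<noteq> aone ?C"
      using h_one h_zero B.zero_neq_one by metis
  qed
  have linA: "Vector_Spaces.linear (ascale A) (*) (aug A)"
    and aug_mult: "aug A (amult A a b) = aug A a * aug A b" and aug_one: "aug A (aone A) = 1" for a b
    using A by (simp_all add: augmented_algebra_def)
  have VA: "vector_space (ascale A)" and VK: "vector_space ((*) :: 'k \<Rightarrow> 'k \<Rightarrow> 'k)"
    using linA by (simp_all add: Vector_Spaces.linear_iff)
  have fst_simps: "fst (amult ?C x y) = amult A (fst x) (fst y)" "fst (ascale ?C s x) = ascale A s (fst x)"
    "fst (aone ?C) = aone A" for x y s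
    by (simp_all add: cocycle_extension_def split: prod.splits)
  have C_scale: "ascale ?C s (0, k) = (0, s * k)" for s k
    using module.scale_zero_right[of "ascale A" s] VA
    by (simp add: cocycle_extension_def vector_space_def module_def)
  have B_scale: "amult B (ascale B s x) y = ascale B s (amult B x y)" for s x y
    using ext by (simp add: extension_def augmented_algebra_def)
  have i_B: "amult B (i k) b = i (aug A (p b) * k)" "amult B (i k) (i k') = 0" for k k' b
    using ext unfolding extension_def by blast+
  have "augmented_algebra ?C"
    unfolding augmented_algebra_def
  proof (intro conjI allI V ring)
    show "amult ?C (ascale ?C s a) b = ascale ?C s (amult ?C a b)" for s a b
      by (rule eqI) (simp add: h_mult h_scale B_scale)
    show "Vector_Spaces.linear (ascale ?C) (*) (aug ?C)"
      using V VK linA by (simp add: Vector_Spaces.linear_iff aug_C fst_simps)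
  qed (simp_all add: aug_C fst_simps aug_mult aug_one)
  moreover have "Vector_Spaces.linear (*) (ascale ?C) (\<lambda>k. (0, k))"
    using V VK by (simp add: Vector_Spaces.linear_iff C_scale)
  moreover have "algebra_hom ?C A fst"
    using V VA by (simp add: algebra_hom_def Vector_Spaces.linear_iff fst_simps)
  moreover have "amult ?C (0, k) b = (0, aug A (fst b) * k)" "amult ?C (0, k) (0, k') = 0" for k k' b
    by (rule eqI, simp add: h_mult hi' i_B(1) ph', rule eqI, simp add: h_mult hi' i_B(2) h_zero)
  ultimately have "extension A ?C (\<lambda>k. (0, k)) fst"
    by (auto simp: extension_def aug_C inj_def surj_def)
  moreover have "extension_iso ?C (\<lambda>k. (0, k)) fst ?C (\<lambda>k. (0, k)) fst"
    using iso extension_iso_sym extension_iso_trans by metis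
  ultimately show ?thesis
    using B f by (auto simp: extension_of_class_def)
qed

text \<open>
  An isomorphism of extensions is compatible with the maps \<open>P\<close> and \<open>I\<close>, so conjugating a lift with
  it gives a lift whose defect is the image of the original one, with the same cochain \<open>\<phi>\<close>.
\<close>
lemma transport_lift:
  fixes A :: "('k::field, 'a::ab_group_add) aug_algebra" and L :: "('k, 'l::ab_group_add) hom_algebra"
    and B :: "('k, 'b::ab_group_add) aug_algebra" and B' :: "('k, 'c::ab_group_add) aug_algebra"
  assumes E: "deformation_extension A B L i p lam" and E': "deformation_extension A B' L i' p' lam"
    and iso: "extension_iso B i p B' i' p'"
    and l: "lifted_operation A B i p L lam br" and \<phi>: "obstruction_cochain B i L br \<phi>"
  shows "\<exists>br'. lifted_operation A B' i' p' L lam br' \<and> obstruction_cochain B' i' L br' \<phi>"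
proof -
  interpret E: deformation_extension A B L i p lam by fact
  interpret E': deformation_extension A B' L i' p' lam by fact
  interpret l: lifted_bracket A B L i p lam br by unfold_locales (fact l)
  obtain h g where h: "algebra_hom B B' h" and g: "algebra_hom B' B g" and gh: "h \<circ> g = id"
    and g_inv: "g \<circ> h = id" and hi: "h \<circ> i = i'" and ph: "p' \<circ> h = p" and pg: "p \<circ> g = p'"
    using iso by (rule extension_isoE) (rule that)
  have lin: "Vector_Spaces.linear (ascale B) (ascale B') h" "Vector_Spaces.linear (ascale B') (ascale B) g"
    using h g by (simp_all add: algebra_hom_def)
  define H where "H = (tensor_map (ascale B') h id :: ('k, 'b, 'l) tensor \<Rightarrow> _)"
  define G where "G = (tensor_map (ascale B) g id :: ('k, 'c, 'l) tensor \<Rightarrow> _)"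
  have HG_in: "u \<in> E.B.T \<Longrightarrow> H u \<in> E'.B.T" "v \<in> E'.B.T \<Longrightarrow> G v \<in> E.B.T" for u v
    unfolding H_def G_def by (rule tensor_map_in_tensor_space[OF _ E.A.linear_ids(2)], rule lin, assumption)+
  have HG_add: "H (u + u') = H u + H u'" "G (v + v') = G v + G v'" for u u' v v'
    by (simp_all add: H_def G_def tensor_map_add)
  have H_diff: "H (u - u') = H u - H u'" for u u'
    using HG_add(1)[of "u - u'" u'] by (simp add: algebra_simps)
  have HG_act: "H (E.B.act b u) = E'.B.act (h b) (H u)" "G (E'.B.act b' v) = E.B.act (g b') (G v)" for b b' u v
    unfolding H_def G_def
    by (rule push_act[OF E'.B.base_change_module_axioms h], rule push_act[OF E.B.base_change_module_axioms g])
  have HG_tw: "H (E.B.tw u) = E'.B.tw (H u)" "G (E'.B.tw v) = E.B.tw (G v)" for u v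
    unfolding H_def G_def
    by (rule push_tw[OF E'.B.base_change_module_axioms E.B.base_change_module_axioms lin(1)],
        rule push_tw[OF E.B.base_change_module_axioms E'.B.base_change_module_axioms lin(2)])
  have HG: "H (G v) = v" if "v \<in> E'.B.T" for v
    using E'.B.tensor_space_eval_outside[OF that]
    by (simp add: H_def G_def tensor_map_compose[OF lin(1)] gh) (auto simp: tensor_map_def fun_eq_iff)
  have P_H: "E'.P (H u) = E.P u" and P_G: "E.P (G v) = E'.P v" for u v
    by (simp_all add: H_def G_def tensor_map_compose[OF E.linear_p] tensor_map_compose[OF E'.linear_p] ph pg)
  have hg_one: "h (aone B) = aone B'" "g (aone B') = aone B" and hg: "h (g b) = b" for b
    using h g gh by (simp_all add: algebra_hom_def fun_eq_iff)
  have H_unit: "H (E.B.unit_tensor x) = E'.B.unit_tensor x" and H_I: "H (E.I x) = E'.I x" for x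
    using hi[symmetric] by (simp_all add: H_def push_pure[OF E'.B.base_change_module_axioms lin(1)] hg_one)
  have G_unit: "G (E'.B.unit_tensor x) = E.B.unit_tensor x" for x
    by (simp add: G_def push_pure[OF E.B.base_change_module_axioms lin(2)] hg_one)
  have GH: "G (H u) = u" if "u \<in> E.B.T" for u
    using E.B.tensor_space_eval_outside[OF that]
    by (simp add: H_def G_def tensor_map_compose[OF lin(2)] g_inv) (auto simp: tensor_map_def fun_eq_iff)
  define br' where "br' u v = H (br (G u) (G v))" for u v
  have "twisted_operation B' L br'"
  proof
    show "bilinear_operation E'.B.act E'.B.T br'"
      unfolding bilinear_operation_def br'_def
      by (simp add: HG_in HG_add HG_act l.br.br_add_left l.br.br_add_right
          l.br.br_act_left l.br.br_act_right hg)
    show "E'.B.tw (br' u v) = br' (E'.B.tw u) (E'.B.tw v)" if "u \<in> E'.B.T" "v \<in> E'.B.T" for u v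
      using that by (simp add: br'_def HG_tw[symmetric] l.br.tw_br HG_in)
  qed
  then have l': "lifted_operation A B' i' p' L lam br'"
    by (simp add: E'.lifted_operation_iff br'_def P_H P_G HG_in)
  interpret l': lifted_bracket A B' L i' p' lam br' by unfold_locales (fact l')
  have "l'.br.defect (E'.B.unit_tensor x) (E'.B.unit_tensor y) (E'.B.unit_tensor z)
      = H (l.br.defect (E.B.unit_tensor x) (E.B.unit_tensor y) (E.B.unit_tensor z))" for x y z
    by (simp add: leibniz_defect_def br'_def HG_add H_diff HG_tw G_unit GH HG_in)
  then have "obstruction_cochain B' i' L br' \<phi>"
    using \<phi> by (simp add: l'.obstruction_cochain_iff l.obstruction_cochain_iff H_I[symmetric])
  with l' show ?thesis by blast
qed

section \<open>The obstruction class decides extendability\<close>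

lemma deformation_extension_of_class:
  assumes "hom_leibniz_algebra L" "augmented_algebra A" "deformation A L lam" "extension_of_class A B i p c"
  shows "deformation_extension A B L i p lam"
  using assms by unfold_locales (auto simp: extension_of_class_def extension_def)

text \<open>
  The obstruction can be computed from every extension of the class, on whatever type, and from every
  lift. Transporting \<open>\<phi>\<close> to an extension on the type of pairs shows that its class satisfies the
  description of the obstruction; transporting any competitor back to \<open>B\<close> and comparing the two
  lifts there shows that it is the only such class.
\<close>
lemma obstruction_eq_cohomology_class:
  fixes A :: "('k::field, 'a::ab_group_add) aug_algebra" and L :: "('k, 'l::ab_group_add) hom_algebra"
    and B :: "('k, 'b::ab_group_add) aug_algebra"
  assumes L: "hom_leibniz_algebra L" and A: "augmented_algebra A" and lam: "deformation A L lam"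
    and B: "extension_of_class A B i p c"
    and l: "lifted_operation A B i p L lam br" and \<phi>: "obstruction_cochain B i L br \<phi>"
  shows "obstruction A L lam c = cohomology_class L 3 \<phi>"
proof -
  note E = deformation_extension_of_class[OF L A lam]
  interpret deformation_extension A B L i p lam by (rule E[OF B])
  interpret lifted_bracket A B L i p lam br by unfold_locales (rule l)
  show ?thesis
    unfolding obstruction_def
  proof (rule the_equality)
    obtain f where C: "extension_of_class A (cocycle_extension A f) (\<lambda>k. (0, k)) fst c"
      using cocycle_extension_of_class[OF A B] by blast
    obtain br' where "lifted_operation A (cocycle_extension A f) (\<lambda>k. (0, k)) fst L lam br'"
      "obstruction_cochain (cocycle_extension A f) (\<lambda>k. (0, k)) L br' \<phi>"
      using transport_lift[OF E[OF B] E[OF C] extensions_of_class_iso[OF A B C] l \<phi>] by blast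
    then show "cohomology_class L 3 \<phi> \<in> cohomology L 3 \<and>
        (\<exists>(B :: ('k, 'a \<times> 'k) aug_algebra) i p br \<phi>'.
           extension_of_class A B i p c \<and> lifted_operation A B i p L lam br \<and>
           obstruction_cochain B i L br \<phi>' \<and> cohomology_class L 3 \<phi> = cohomology_class L 3 \<phi>')"
      using C obstruction_cocycle[OF \<phi>] unfolding cohomology_def by blast
  next
    fix h
    assume "h \<in> cohomology L 3 \<and>
        (\<exists>(B :: ('k, 'a \<times> 'k) aug_algebra) i p br \<phi>.
           extension_of_class A B i p c \<and> lifted_operation A B i p L lam br \<and>
           obstruction_cochain B i L br \<phi> \<and> h = cohomology_class L 3 \<phi>)"
    then obtain B1 :: "('k, 'a \<times> 'k) aug_algebra" and i1 p1 br1 \<phi>1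
      where B1: "extension_of_class A B1 i1 p1 c" and l1: "lifted_operation A B1 i1 p1 L lam br1"
        and \<phi>1: "obstruction_cochain B1 i1 L br1 \<phi>1" and h: "h = cohomology_class L 3 \<phi>1"
      by blast
    obtain br' where "lifted_operation A B i p L lam br'" "obstruction_cochain B i L br' \<phi>1"
      using transport_lift[OF E[OF B1] E[OF B] extensions_of_class_iso[OF A B1 B] l1 \<phi>1] by blast
    then show "h = cohomology_class L 3 \<phi>"
      unfolding h using obstruction_cochains_cohomologous[OF _ _ l \<phi>] by blast
  qed
qed

theorem proposition4p7:
  fixes A :: "('k::{alg_closed_field,field_char_0}, 'a::ab_group_add) aug_algebra"
    and B :: "('k, 'b::ab_group_add) aug_algebra"
    and L :: "('k, 'l::ab_group_add) hom_algebra"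
    and lam :: "('k, 'a, 'l) tensor \<Rightarrow> ('k, 'a, 'l) tensor \<Rightarrow> ('k, 'a, 'l) tensor"
    and i :: "'k \<Rightarrow> 'b" and p :: "'b \<Rightarrow> 'a" and f :: "'a \<Rightarrow> 'a \<Rightarrow> 'k"
  assumes "hom_leibniz_algebra L"
    and "augmented_algebra A" "finite_dimensional_algebra A" "local_algebra A"
    and "deformation A L lam"
    and "f \<in> harrison_cocycles A"
    and "extension_of_class A B i p (harrison_class A f)"
  shows "(\<exists>mu. deformation B L mu \<and> is_push_out B A L p mu lam) \<longleftrightarrow>
    obstruction A L lam (harrison_class A f) = cohomology_class L 3 0"
proof -
  interpret deformation_extension A B L i p lam
    by (rule deformation_extension_of_class) fact+
  note obstruction = obstruction_eq_cohomology_class[OF assms(1,2,5,7)]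
  show ?thesis
  proof
    assume "\<exists>mu. deformation B L mu \<and> is_push_out B A L p mu lam"
    then obtain mu where mu: "lifted_operation A B i p L lam mu"
      and leibniz: "\<And>u v w. u \<in> B.T \<Longrightarrow> v \<in> B.T \<Longrightarrow> w \<in> B.T \<Longrightarrow> leibniz_defect B.tw mu u v w = 0"
      unfolding deformation_iff_lift by blast
    interpret mu: lifted_bracket A B L i p lam mu by unfold_locales (rule mu)
    have "obstruction_cochain B i L mu 0"
      by (simp add: mu.obstruction_cochain_iff leibniz A.zero_in_cochains zero_fun_apply)
    then show "obstruction A L lam (harrison_class A f) = cohomology_class L 3 0"
      by (rule obstruction[OF mu])
  next
    assume zero: "obstruction A L lam (harrison_class A f) = cohomology_class L 3 0"
    obtain br where br: "lifted_operation A B i p L lam br"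
      using lift_exists[OF assms(3)] by blast
    interpret br: lifted_bracket A B L i p lam br by unfold_locales (rule br)
    obtain \<phi> where \<phi>: "obstruction_cochain B i L br \<phi>"
      using br.obstruction_cochain_exists by blast
    have "\<phi> - 0 \<in> coboundaries L 3"
      using zero obstruction[OF br \<phi>] by (simp only: A.cohomology_class_eq_iff)
    then obtain \<psi> where \<psi>: "\<psi> \<in> cochains L 2" and \<phi>\<psi>: "\<phi> = coboundary L 2 \<psi>"
      by (auto simp: coboundaries_def)
    \<comment> \<open>By \<open>defect_shift\<close>, subtracting \<open>\<psi>\<close> from the lift subtracts \<open>\<delta> \<psi> = \<phi>\<close> from its defect.\<close>
    define mu where "mu u v = br u v - I (\<psi> [B.ctr u, B.ctr v])" for u v
    have mu: "lifted_operation A B i p L lam mu"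
      unfolding mu_def using shifted_lift[OF br \<psi>] .
    have "leibniz_defect B.tw mu u v w = 0" if T: "u \<in> B.T" "v \<in> B.T" "w \<in> B.T" for u v w
    proof -
      have "leibniz_defect B.tw br u v w
          = leibniz_defect B.tw mu u v w + I (coboundary L 2 \<psi> [B.ctr u, B.ctr v, B.ctr w])"
        by (rule defect_shift[OF br mu \<psi> _ T]) (simp add: mu_def)
      then show ?thesis
        using br.defect_eq[OF \<phi> T] by (simp add: \<phi>\<psi>)
    qed
    then show "\<exists>mu. deformation B L mu \<and> is_push_out B A L p mu lam"
      using mu deformation_iff_lift by blast
  qed
qed

end
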